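(* Let $\sigma\in\{0,1\}$, $\nu>0$ and $T>0$. Consider the solution $f$ of $$\partial_tf+V(t,y)\partial_xf=\nu(\sigma\partial_x^2+\partial_y^2)f,\qquad f(t=0,x,y)=f_0(x,y),$$ on $\mathbb{T}^2$, initiated from smooth initial data $f_0\in C^\infty(\mathbb{T}^2)$. Assume that the shear flow $V(t,y)\in C^2_{t,y}$ satisfies the following structure assumptions on the time interval $[0,T]$. (a) (Phase assumption) There exists a nondegenerate reference shear $U\in C^1_tC^2_y$ such that the time-dependent flow $V(t,y)$ and the reference flow $U(t,y)$ share all their nondegenerate critical points $\{y_i(t)\}_{i=1}^N$, where $N$ is a fixed finite number. Moreover, $$\partial_yV(t,y)\,\partial_yU(t,y)\ge0,\qquad\forall y\in\mathbb{T},\ \forall t\in[0,T],$$ $$\|\partial_{ty}U\|_{L^\infty_t([0,T];L^\infty_y)}\le\nu^{3/4},\qquad \|V\|_{L^\infty_t([0,T];W^{2,\infty}_y)}+\|U\|_{L^\infty_t([0,T];W^{2,\infty}_y)}<C .$$ (b) (Shape assumption) There exist $N$ pairwise disjoint open neighborhoods $\{B_r(y_i(t))\}_{i=1}^N$ with fixed radius $0<r=\mathcal{O}(1)$, and two constants $\mathfrak{C}_0,\mathfrak{C}_1>1$, such that for $Z\in\{V,U\}$, $$\mathfrak{C}_0^{-1}(y-y_i(t))^2\le|\partial_yZ(t,y)|^2\le\mathfrak{C}_0(y-y_i(t))^2,\qquad\forall y\in B_r(y_i(t)),$$ $$0<\mathfrak{C}_1^{-1}\le|\partial_yZ(t,y)|\le\mathfrak{C}_1,\qquad\forall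 y\notin\bigcup_{i=1}^NB_r(y_i(t)).$$ Then there exists a threshold $\nu_0=\nu_0(U,V)$ such that if $\nu\le\nu_0$, the following estimate holds: $$\|f_k(t)\|_{L^2}\le e\,\|f_k(0)\|_{L^2}\exp\left\{-\delta\,\nu^{1/2}|k|^{1/2}\,t\right\},\qquad\forall t\in[0,T],$$ with $\delta>0$ depending on the functions $U,V$; in particular, $\delta$ depends only on the parameters specified in the conditions above.
   Context: $\mathbb{T}=[-\pi,\pi]$ is the torus; $B_r(y_i)$ is the open ball of radius $r$ about $y_i$ in $\mathbb{T}$. $k\in\mathbb{Z}$ is the Fourier frequency in $x$, and $f_k(t,y)$ is the $k$-th Fourier coefficient of $f(t,\cdot,y)$ in $x$; it solves $\partial_tf_k+ikVf_k=\nu\partial_y^2f_k-\sigma\nu|k|^2f_k$ on $\mathbb{T}$. $L^2$ norms of $f_k$ are taken in $y\in\mathbb{T}$. A critical point of $Z(t,\cdot)$ is a point $y_\ast$ with $\partial_yZ(t,y_\ast)=0$; a shear is nondegenerate if its second $y$-derivative does not vanish at its critical points (is bounded below there in absolute value by some $c>0$). $\|g\|_{L^\infty_tW^{m,\infty}_y}$ is the essential supremum over $t$ of the $W^{m,\infty}$-norm in $y$. $C$ denotes a finite constant independent of $\nu$ and $k$. *)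

theory Defs
  imports "HOL-Analysis.Analysis" "HOL-Probability.Essential_Supremum"
begin

text \<open>
  Functions on the torus are functions of a real variable with period \<open>2 * pi\<close>; norms and
  integrals are taken over the fundamental domain \<open>{-pi..pi}\<close>.  A point of the torus is given by
  an arbitrary real representative.
\<close>

definition torus_class :: "real \<Rightarrow> real set" where
  "torus_class z = range (\<lambda>n::int. z + 2 * pi * of_int n)"

text \<open>
  The quotient metric.  It is what \<open>\<bar>y - z\<bar>\<close> means for points of the torus: a ball centred near
  \<open>pi\<close> wraps around to \<open>-pi\<close>.
\<close>

definition torus_dist :: "real \<Rightarrow> real \<Rightarrow> real" where
  "torus_dist y z = infdist y (torus_class z)"

definition torus_ball :: "real \<Rightarrow> real \<Rightarrow> real set" where
  "torus_ball z r = {y. torus_dist y z < r}"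

definition periodic :: "(real \<Rightarrow> 'a) \<Rightarrow> bool" where
  "periodic g \<longleftrightarrow> (\<forall>y. g (y + 2 * pi) = g y)"

text \<open>
  Partial derivatives of a function on \<open>S \<times> \<real>\<close>.  For \<open>S = {0..T}\<close> the derivative in the first
  variable is one-sided at the end points.
\<close>

definition D1 :: "real set \<Rightarrow> (real \<Rightarrow> real \<Rightarrow> 'a::real_normed_vector) \<Rightarrow> real \<Rightarrow> real \<Rightarrow> 'a" where
  "D1 S g t y = vector_derivative (\<lambda>s. g s y) (at t within S)"

definition D2 :: "(real \<Rightarrow> real \<Rightarrow> 'a::real_normed_vector) \<Rightarrow> real \<Rightarrow> real \<Rightarrow> 'a" where
  "D2 g t y = vector_derivative (g t) (at y)"

definition diff1 :: "real set \<Rightarrow> (real \<Rightarrow> real \<Rightarrow> 'a::real_normed_vector) \<Rightarrow> bool" where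
  "diff1 S g \<longleftrightarrow> (\<forall>t\<in>S. \<forall>y. (\<lambda>s. g s y) differentiable (at t within S))"

definition diff2 :: "real set \<Rightarrow> (real \<Rightarrow> real \<Rightarrow> 'a::real_normed_vector) \<Rightarrow> bool" where
  "diff2 S g \<longleftrightarrow> (\<forall>t\<in>S. \<forall>y. g t differentiable (at y))"

definition jointly_cont :: "real set \<Rightarrow> (real \<Rightarrow> real \<Rightarrow> 'a::real_normed_vector) \<Rightarrow> bool" where
  "jointly_cont S g \<longleftrightarrow> continuous_on (S \<times> UNIV) (\<lambda>(t, y). g t y)"

primrec C_diff :: "nat \<Rightarrow> real set \<Rightarrow> (real \<Rightarrow> real \<Rightarrow> 'a::real_normed_vector) \<Rightarrow> bool" where
  "C_diff 0 S g \<longleftrightarrow> jointly_cont S g"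
| "C_diff (Suc n) S g \<longleftrightarrow>
     jointly_cont S g \<and> diff1 S g \<and> diff2 S g \<and> C_diff n S (D1 S g) \<and> C_diff n S (D2 g)"

text \<open>\<open>C\<^sup>1\<close> in time with values in \<open>C\<^sup>2\<close> in space.\<close>

definition C1t_C2y :: "real \<Rightarrow> (real \<Rightarrow> real \<Rightarrow> real) \<Rightarrow> bool" where
  "C1t_C2y T g \<longleftrightarrow>
     diff2 {0..T} g \<and> diff2 {0..T} (D2 g) \<and>
     (\<forall>h \<in> {g, D2 g, D2 (D2 g)}.
        jointly_cont {0..T} h \<and> diff1 {0..T} h \<and> jointly_cont {0..T} (D1 {0..T} h))"

definition Linf_norm :: "(real \<Rightarrow> real) \<Rightarrow> ereal" where
  "Linf_norm g = esssup (lebesgue_on {-pi..pi}) (\<lambda>y. ereal \<bar>g y\<bar>)"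

definition Linf_Wminf_norm :: "real \<Rightarrow> nat \<Rightarrow> (real \<Rightarrow> real \<Rightarrow> real) \<Rightarrow> ereal" where
  "Linf_Wminf_norm T m Z =
     esssup (lebesgue_on {0..T}) (\<lambda>t. \<Sum>j\<le>m. Linf_norm ((D2 ^^ j) Z t))"

definition L2_norm_torus :: "(real \<Rightarrow> complex) \<Rightarrow> real" where
  "L2_norm_torus g = sqrt (integral {-pi..pi} (\<lambda>y. (cmod (g y))\<^sup>2))"

definition fourier_coeff ::
    "int \<Rightarrow> (real \<Rightarrow> real \<Rightarrow> real \<Rightarrow> complex) \<Rightarrow> real \<Rightarrow> real \<Rightarrow> complex" where
  "fourier_coeff k f t y =
     integral {-pi..pi} (\<lambda>x. f t x y * exp (- \<i> * of_int k * of_real x)) / of_real (2 * pi)"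

definition smooth_on_torus2 :: "(real \<Rightarrow> real \<Rightarrow> complex) \<Rightarrow> bool" where
  "smooth_on_torus2 g \<longleftrightarrow>
     (\<forall>y. periodic (\<lambda>x. g x y)) \<and> (\<forall>x. periodic (g x)) \<and> (\<forall>n. C_diff n UNIV g)"

text \<open>
  Classical solutions on \<open>[0,T] \<times> \<T>\<^sup>2\<close>, arguments in the order \<open>t\<close>, \<open>x\<close>, \<open>y\<close>.  Continuity is
  required of \<open>f\<close> and of those derivatives that occur in the equation, so of \<open>fxx\<close> only if
  \<open>\<sigma> \<noteq> 0\<close>.
\<close>

definition classical_solution ::
    "real \<Rightarrow> real \<Rightarrow> real \<Rightarrow> (real \<Rightarrow> real \<Rightarrow> real) \<Rightarrow> (real \<Rightarrow> real \<Rightarrow> complex) \<Rightarrow>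
     (real \<Rightarrow> real \<Rightarrow> real \<Rightarrow> complex) \<Rightarrow> bool" where
  "classical_solution \<sigma> \<nu> T V f0 f \<longleftrightarrow>
     (\<forall>t\<in>{0..T}. (\<forall>y. periodic (\<lambda>x. f t x y)) \<and> (\<forall>x. periodic (f t x))) \<and>
     (\<forall>x y. f 0 x y = f0 x y) \<and>
     (\<exists>ft fx fxx fy fyy.
        (\<forall>g \<in> {f, ft, fx, fy, fyy}.
           continuous_on ({0..T} \<times> UNIV \<times> UNIV) (\<lambda>(t, x, y). g t x y)) \<and>
        (\<sigma> \<noteq> 0 \<longrightarrow> continuous_on ({0..T} \<times> UNIV \<times> UNIV) (\<lambda>(t, x, y). fxx t x y)) \<and>
        (\<forall>t\<in>{0..T}. \<forall>x y.
           ((\<lambda>s. f s x y) has_vector_derivative ft t x y) (at t within {0..T}) \<and>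
           ((\<lambda>x. f t x y) has_vector_derivative fx t x y) (at x) \<and>
           (\<sigma> \<noteq> 0 \<longrightarrow> ((\<lambda>x. fx t x y) has_vector_derivative fxx t x y) (at x)) \<and>
           (f t x has_vector_derivative fy t x y) (at y) \<and>
           (fy t x has_vector_derivative fyy t x y) (at y) \<and>
           ft t x y + of_real (V t y) * fx t x y =
             of_real \<nu> * (of_real \<sigma> * fxx t x y + fyy t x y)))"

definition nondegenerate_shear :: "real \<Rightarrow> (real \<Rightarrow> real \<Rightarrow> real) \<Rightarrow> bool" where
  "nondegenerate_shear T Z \<longleftrightarrow>
     (\<exists>c>0. \<forall>t\<in>{0..T}. \<forall>y. D2 Z t y = 0 \<longrightarrow> c \<le> \<bar>D2 (D2 Z) t y\<bar>)"

definition critical_points_are ::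
    "real \<Rightarrow> nat \<Rightarrow> (nat \<Rightarrow> real \<Rightarrow> real) \<Rightarrow> (real \<Rightarrow> real \<Rightarrow> real) \<Rightarrow> bool" where
  "critical_points_are T N ys Z \<longleftrightarrow>
     (\<forall>t\<in>{0..T}. {y. D2 Z t y = 0} = (\<Union>i\<in>{1..N}. torus_class (ys i t)))"

definition phase_assumption ::
    "real \<Rightarrow> nat \<Rightarrow> real \<Rightarrow> real \<Rightarrow> (real \<Rightarrow> real \<Rightarrow> real) \<Rightarrow> (real \<Rightarrow> real \<Rightarrow> real) \<Rightarrow>
     (nat \<Rightarrow> real \<Rightarrow> real) \<Rightarrow> bool" where
  "phase_assumption C N \<nu> T V U ys \<longleftrightarrow>
     (\<forall>t\<in>{0..T}. periodic (U t)) \<and> C1t_C2y T U \<and>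
     nondegenerate_shear T U \<and> nondegenerate_shear T V \<and>
     critical_points_are T N ys V \<and> critical_points_are T N ys U \<and>
     (\<forall>t\<in>{0..T}. \<forall>y. 0 \<le> D2 V t y * D2 U t y) \<and>
     Linf_Wminf_norm T 0 (D1 {0..T} (D2 U)) \<le> ereal (\<nu> powr (3/4)) \<and>
     Linf_Wminf_norm T 2 V + Linf_Wminf_norm T 2 U < ereal C"

definition shape_assumption ::
    "real \<Rightarrow> real \<Rightarrow> real \<Rightarrow> nat \<Rightarrow> real \<Rightarrow> (real \<Rightarrow> real \<Rightarrow> real) \<Rightarrow> (real \<Rightarrow> real \<Rightarrow> real) \<Rightarrow>
     (nat \<Rightarrow> real \<Rightarrow> real) \<Rightarrow> bool" where
  "shape_assumption r C0 C1 N T V U ys \<longleftrightarrow>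
     (\<forall>t\<in>{0..T}.
        disjoint_family_on (\<lambda>i. torus_ball (ys i t) r) {1..N} \<and>
        (\<forall>Z\<in>{V, U}.
           (\<forall>i\<in>{1..N}. \<forall>y\<in>torus_ball (ys i t) r.
              inverse C0 * (torus_dist y (ys i t))\<^sup>2 \<le> \<bar>D2 Z t y\<bar>\<^sup>2 \<and>
              \<bar>D2 Z t y\<bar>\<^sup>2 \<le> C0 * (torus_dist y (ys i t))\<^sup>2) \<and>
           (\<forall>y. y \<notin> (\<Union>i\<in>{1..N}. torus_ball (ys i t) r) \<longrightarrow>
              inverse C1 \<le> \<bar>D2 Z t y\<bar> \<and> \<bar>D2 Z t y\<bar> \<le> C1)))"

end

theory Submission
  imports Defs
begin

text \<open>
  Hypocoercivity with a time-dependent functional.  For the mode \<open>g = f\<^sub>k\<close> consider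
  \<open>F = 1/2 \<parallel>g\<parallel>\<^sup>2 + \<alpha> \<parallel>\<partial>\<^sub>y g\<parallel>\<^sup>2 + \<beta> Re \<langle>i U\<^sub>y g, \<partial>\<^sub>y g\<rangle> + \<gamma> \<parallel>U\<^sub>y g\<parallel>\<^sup>2\<close> with the usual powers of \<open>\<nu>\<close> and
  \<open>\<bar>k\<bar>\<close> in the weights.  The commutator of the transport term with the mixed term yields
  \<open>- \<bar>k\<bar> \<integral> U\<^sub>y V\<^sub>y \<bar>g\<bar>\<^sup>2\<close>, which the phase and shape assumptions make comparable with
  \<open>- \<bar>k\<bar> \<parallel>U\<^sub>y g\<parallel>\<^sup>2\<close>; together with \<open>- \<nu> \<parallel>\<partial>\<^sub>y g\<parallel>\<^sup>2\<close> it controls \<open>(\<nu> \<bar>k\<bar>)\<^sup>1\<^sup>/\<^sup>2 \<parallel>g\<parallel>\<^sup>2\<close>, because \<open>U\<^sub>y\<close> vanishes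
  only linearly.  The hypothesis \<open>\<parallel>\<partial>\<^sub>t\<^sub>y U\<parallel> \<le> \<nu>\<^sup>3\<^sup>/\<^sup>4\<close> is exactly what absorbs the terms containing \<open>\<partial>\<^sub>t\<^sub>y U\<close>.
  To start from \<open>L\<^sup>2\<close> data, the weights of the last three terms carry factors \<open>\<tau>\<close>, \<open>\<tau>\<^sup>2\<close>, \<open>\<tau>\<^sup>3\<close>
  where \<open>\<tau>(s) = s / t\<close> and \<open>t\<close> is the time at which the norm is estimated: then
  \<open>F' \<le> - C (\<nu> \<bar>k\<bar>)\<^sup>1\<^sup>/\<^sup>2 \<tau>\<^sup>2 F\<close> on \<open>[0, t]\<close> as soon as \<open>(\<nu> \<bar>k\<bar>)\<^sup>1\<^sup>/\<^sup>2 t \<ge> 1\<close>, and for shorter times the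
  monotonicity of \<open>\<parallel>g\<parallel>\<close> suffices.
\<close>

section \<open>Periodic functions\<close>

lemma periodic_has_integral_deriv:
  fixes h :: "real \<Rightarrow> 'a::banach"
  assumes "periodic h" "\<And>y. (h has_vector_derivative h' y) (at y)"
  shows "(h' has_integral 0) {-pi..pi}"
proof -
  have "(h' has_integral (h pi - h (-pi))) {-pi..pi}"
    by (rule fundamental_theorem_of_calculus)
       (use assms(2) in \<open>auto intro: has_vector_derivative_at_within\<close>)
  moreover have "h pi = h (-pi)"
    using assms(1)[unfolded periodic_def, rule_format, of "-pi"] by simp
  ultimately show ?thesis by simp
qed

lemma has_vector_derivative_shift:
  fixes h :: "real \<Rightarrow> 'a::real_normed_vector"
  assumes "(h has_vector_derivative h') (at (y + c))"
  shows "((\<lambda>x. h (x + c)) has_vector_derivative h') (at y)"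
proof -
  have "((\<lambda>x. x + c) has_vector_derivative 1) (at y)"
    by (simp flip: has_real_derivative_iff_has_vector_derivative)
       (auto intro!: derivative_eq_intros)
  from vector_diff_chain_at[OF this, of h h'] assms show ?thesis by (simp add: o_def)
qed

lemma periodic_vector_derivative:
  fixes h :: "real \<Rightarrow> 'a::real_normed_vector"
  assumes "periodic h" "\<And>y. (h has_vector_derivative h' y) (at y)"
  shows "periodic h'"
  unfolding periodic_def
proof
  fix y
  have "((\<lambda>x. h (x + 2 * pi)) has_vector_derivative h' (y + 2 * pi)) (at y)"
    by (rule has_vector_derivative_shift) (rule assms(2))
  moreover have "(\<lambda>x. h (x + 2 * pi)) = h"
    using assms(1) by (auto simp: periodic_def)
  ultimately show "h' (y + 2 * pi) = h' y"
    using assms(2) vector_derivative_unique_at by metis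
qed

section \<open>Translations on the torus and a degenerate-weight inequality\<close>

lemma integral_periodic_shift:
  fixes h :: "real \<Rightarrow> real"
  assumes per: "periodic h" and cont: "continuous_on UNIV h" and s: "0 \<le> s" "s \<le> 2 * pi"
  shows "integral {-pi..pi} (\<lambda>y. h (y + s)) = integral {-pi..pi} h"
proof -
  have int: "h integrable_on {a..b}" for a b
    by (rule integrable_continuous_real) (rule continuous_on_subset[OF cont subset_UNIV])
  have "integral {-pi..pi} (\<lambda>y. h (y + s)) = integral {-pi + s..pi + s} h"
    using integral_shift_real_ivl[of "-pi + s" s "pi + s" h] by simp
  also have "\<dots> = integral {-pi + s..pi} h + integral {pi..pi + s} h"
    by (rule Henstock_Kurzweil_Integration.integral_combine[symmetric]) (use s int in auto)
  also have "integral {pi..pi + s} h = integral {-pi..-pi + s} (\<lambda>y. h (y + 2 * pi))"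
    using integral_shift_real_ivl[of pi "2 * pi" "pi + s" h] by (simp add: algebra_simps)
  also have "\<dots> = integral {-pi..-pi + s} h"
    using per by (simp add: periodic_def)
  also have "integral {-pi + s..pi} h + \<dots> = integral {-pi..pi} h"
    using Henstock_Kurzweil_Integration.integral_combine[of "-pi" "-pi + s" pi h] s int by auto
  finally show ?thesis .
qed

text \<open>Cauchy-Schwarz by absorption: the increment \<open>v\<close> is the integral of
  \<open>f'\<close>, so |v|^2 is the integral of \<open>inner v f'\<close>, and Young's inequality
  with weight \<open>s\<close> gives back half of |v|^2.\<close>

lemma norm_increment_sq_le:
  fixes f :: "real \<Rightarrow> 'a::euclidean_space"
  assumes "\<And>y. (f has_vector_derivative f' y) (at y)" and cont: "continuous_on UNIV f'"
    and s: "0 < s"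
  shows "(norm (f (y + s) - f y))\<^sup>2 \<le> s * integral {0..s} (\<lambda>\<theta>. (norm (f' (y + \<theta>)))\<^sup>2)"
proof -
  define v where "v = f (y + s) - f y"
  have c: "continuous_on {0..s} (\<lambda>\<theta>. f' (y + \<theta>))"
    by (rule continuous_on_compose2[OF cont]) (auto intro!: continuous_intros)
  have "((\<lambda>\<theta>. f (y + \<theta>)) has_vector_derivative f' (y + \<theta>)) (at \<theta>)" for \<theta>
    using has_vector_derivative_shift[of f "f' (y + \<theta>)" \<theta> y] assms(1) by (simp add: add.commute)
  then have "((\<lambda>\<theta>. f' (y + \<theta>)) has_integral v) {0..s}"
    using fundamental_theorem_of_calculus[of 0 s "\<lambda>\<theta>. f (y + \<theta>)" "\<lambda>\<theta>. f' (y + \<theta>)"] s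
    by (auto simp: v_def intro: has_vector_derivative_at_within)
  then have 1: "((\<lambda>\<theta>. inner v (f' (y + \<theta>))) has_integral inner v v) {0..s}"
    using has_integral_linear[OF _ bounded_linear_inner_right, of "\<lambda>\<theta>. f' (y + \<theta>)" v "{0..s}" v]
    by (simp add: o_def)
  have 2: "(\<lambda>\<theta>. (norm (f' (y + \<theta>)))\<^sup>2) integrable_on {0..s}"
    by (rule integrable_continuous_real) (intro continuous_intros c)
  have "inner v v = integral {0..s} (\<lambda>\<theta>. inner v (f' (y + \<theta>)))"
    using 1 by (simp add: integral_unique)
  also have "\<dots> \<le> integral {0..s} (\<lambda>\<theta>. (norm v)\<^sup>2 / (2 * s) + s / 2 * (norm (f' (y + \<theta>)))\<^sup>2)"
  proof (rule integral_le)
    show "(\<lambda>\<theta>. inner v (f' (y + \<theta>))) integrable_on {0..s}" using 1 by blast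
    show "(\<lambda>\<theta>. (norm v)\<^sup>2 / (2 * s) + s / 2 * (norm (f' (y + \<theta>)))\<^sup>2) integrable_on {0..s}"
      by (rule integrable_continuous_real) (intro continuous_intros c, use s in auto)
    fix \<theta>
    have "inner v (f' (y + \<theta>)) \<le> norm v * norm (f' (y + \<theta>))" by (rule norm_cauchy_schwarz)
    also have "\<dots> \<le> (norm v)\<^sup>2 / (2 * s) + s / 2 * (norm (f' (y + \<theta>)))\<^sup>2"
      using s sum_squares_bound[of "norm v" "s * norm (f' (y + \<theta>))"]
      by (simp add: field_simps power2_eq_square)
    finally show "inner v (f' (y + \<theta>)) \<le> (norm v)\<^sup>2 / (2 * s) + s / 2 * (norm (f' (y + \<theta>)))\<^sup>2" .
  qed
  also have "\<dots> = (norm v)\<^sup>2 / 2 + s / 2 * integral {0..s} (\<lambda>\<theta>. (norm (f' (y + \<theta>)))\<^sup>2)"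
    using s 2 by (subst Henstock_Kurzweil_Integration.integral_add) auto
  finally show ?thesis by (simp add: v_def flip: power2_norm_eq_inner)
qed

text \<open>After exchanging the two integrals, the inner one runs over a full period and does not
  see the translation by \<open>\<theta>\<close>; the second factor \<open>s\<close> is the length
  of the range of \<open>\<theta>\<close>.\<close>

lemma integral_norm_increment_sq_le:
  fixes f :: "real \<Rightarrow> 'a::euclidean_space"
  assumes der: "\<And>y. (f has_vector_derivative f' y) (at y)" and cont: "continuous_on UNIV f'"
    and per: "periodic f'" and s: "0 < s" "s \<le> 2 * pi"
  shows "integral {-pi..pi} (\<lambda>y. (norm (f (y + s) - f y))\<^sup>2)
    \<le> s\<^sup>2 * integral {-pi..pi} (\<lambda>y. (norm (f' y))\<^sup>2)"
proof -
  have cf: "continuous_on A f" for A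
    using der by (meson continuous_on_subset continuous_on_vector_derivative
        has_vector_derivative_at_within subset_UNIV)
  have c2: "continuous_on A (\<lambda>(y, \<theta>). (norm (f' (y + \<theta>)))\<^sup>2)" for A
    unfolding split_beta
    by (intro continuous_intros continuous_on_compose2[OF cont]) auto
  have c1: "continuous_on {-pi..pi} (\<lambda>y. integral {0..s} (\<lambda>\<theta>. (norm (f' (y + \<theta>)))\<^sup>2))"
    using integral_continuous_on_param[of "{-pi..pi}" 0 s "\<lambda>y \<theta>. (norm (f' (y + \<theta>)))\<^sup>2"] c2
    by (auto simp: split_beta)
  have "integral {-pi..pi} (\<lambda>y. (norm (f (y + s) - f y))\<^sup>2)
      \<le> integral {-pi..pi} (\<lambda>y. s * integral {0..s} (\<lambda>\<theta>. (norm (f' (y + \<theta>)))\<^sup>2))"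
    by (rule integral_le)
      (auto intro!: integrable_continuous_real continuous_intros c1
        continuous_on_compose2[OF cf[of UNIV]] cf norm_increment_sq_le[OF der cont s(1)])
  also have "\<dots> = s * integral {0..s} (\<lambda>\<theta>. integral {-pi..pi} (\<lambda>y. (norm (f' (y + \<theta>)))\<^sup>2))"
    using integral_swap_continuous[of "-pi" 0 pi s "\<lambda>y \<theta>. (norm (f' (y + \<theta>)))\<^sup>2"] c2
    by (auto simp: split_beta)
  also have "integral {0..s} (\<lambda>\<theta>. integral {-pi..pi} (\<lambda>y. (norm (f' (y + \<theta>)))\<^sup>2))
      = integral {0..s} (\<lambda>\<theta>. integral {-pi..pi} (\<lambda>y. (norm (f' y))\<^sup>2))"
  proof (rule Henstock_Kurzweil_Integration.integral_cong)
    fix \<theta> assume "\<theta> \<in> {0..s}"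
    then show "integral {-pi..pi} (\<lambda>y. (norm (f' (y + \<theta>)))\<^sup>2)
        = integral {-pi..pi} (\<lambda>y. (norm (f' y))\<^sup>2)"
      using s per by (intro integral_periodic_shift)
        (auto simp: periodic_def intro!: continuous_intros cont)
  qed
  finally show ?thesis using s by (simp add: power2_eq_square)
qed

text \<open>
  Replaces the spectral gap of the semiclassical operator \<open>- \<eta>\<^sup>4 \<partial>\<^sub>y\<^sup>2 + W\<^sup>2\<close>: where \<open>W\<close> is small, a
  translation by \<open>2 * \<eta>\<close> leads to a point where it is not, and the translation costs one derivative.
\<close>

lemma degenerate_weight_interpolation:
  fixes f :: "real \<Rightarrow> 'a::euclidean_space" and W :: "real \<Rightarrow> real"
  assumes der: "\<And>y. (f has_vector_derivative f' y) (at y)" and cont: "continuous_on UNIV f'"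
    and per: "periodic f" and W: "continuous_on UNIV W" "periodic W"
    and \<eta>: "0 < \<eta>" "\<eta> \<le> pi" and m: "0 \<le> m"
    and shift: "\<And>y. m \<le> (W y)\<^sup>2 \<or> m \<le> (W (y + 2 * \<eta>))\<^sup>2"
  shows "m * integral {-pi..pi} (\<lambda>y. (norm (f y))\<^sup>2)
    \<le> 3 * integral {-pi..pi} (\<lambda>y. (W y)\<^sup>2 * (norm (f y))\<^sup>2)
      + 8 * m * \<eta>\<^sup>2 * integral {-pi..pi} (\<lambda>y. (norm (f' y))\<^sup>2)"
proof -
  have cf: "continuous_on A f" for A
    using der by (meson continuous_on_subset continuous_on_vector_derivative
        has_vector_derivative_at_within subset_UNIV)
  have cW: "continuous_on A W" for A
    using W(1) continuous_on_subset by blast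
  let ?h = "\<lambda>y. (W y)\<^sup>2 * (norm (f y))\<^sup>2"
  let ?d = "\<lambda>y. (norm (f (y + 2 * \<eta>) - f y))\<^sup>2"
  have ch: "continuous_on A ?h" for A by (intro continuous_intros cW cf)
  have chs: "continuous_on A (\<lambda>y. ?h (y + 2 * \<eta>))" for A
    by (rule continuous_on_compose2[OF ch[of UNIV]]) (auto intro!: continuous_intros)
  have cd: "continuous_on A ?d" for A
    by (intro continuous_intros cf continuous_on_compose2[OF cf[of UNIV]]) auto
  \<comment> \<open>The right-hand side covers both cases of \<open>shift\<close>. If the weight is
    large only at \<open>y + 2 * \<eta>\<close>, then |f(y)|^2 is at most twice |f|^2 there plus
    twice the squared increment.\<close>
  have pt: "m * (norm (f y))\<^sup>2 \<le> ?h y + 2 * ?h (y + 2 * \<eta>) + 2 * m * ?d y" for y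
    using shift[of y]
  proof
    assume "m \<le> (W y)\<^sup>2"
    then have "m * (norm (f y))\<^sup>2 \<le> ?h y" by (intro mult_right_mono) auto
    moreover have "0 \<le> 2 * ?h (y + 2 * \<eta>) + 2 * m * ?d y" using m by auto
    ultimately show ?thesis by linarith
  next
    assume w: "m \<le> (W (y + 2 * \<eta>))\<^sup>2"
    let ?a = "norm (f (y + 2 * \<eta>))" and ?b = "norm (f (y + 2 * \<eta>) - f y)"
    have "norm (f y) \<le> ?a + ?b" using norm_triangle_ineq4[of "f (y + 2 * \<eta>)" "f (y + 2 * \<eta>) - f y"]
      by simp
    then have "(norm (f y))\<^sup>2 \<le> (?a + ?b)\<^sup>2" by (intro power_mono) auto
    also have "\<dots> \<le> 2 * ?a\<^sup>2 + 2 * ?b\<^sup>2"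
      using sum_squares_bound[of ?a ?b] by (simp add: power2_sum)
    finally have "m * (norm (f y))\<^sup>2 \<le> m * (2 * ?a\<^sup>2 + 2 * ?b\<^sup>2)" using m by (rule mult_left_mono)
    also have "\<dots> = 2 * (m * ?a\<^sup>2) + 2 * m * ?d y" by (simp add: algebra_simps)
    also have "m * ?a\<^sup>2 \<le> ?h (y + 2 * \<eta>)" by (intro mult_right_mono w) auto
    finally show ?thesis by (smt (verit) mult_nonneg_nonneg zero_le_power2)
  qed
  have "m * integral {-pi..pi} (\<lambda>y. (norm (f y))\<^sup>2)
      = integral {-pi..pi} (\<lambda>y. m * (norm (f y))\<^sup>2)" by simp
  also have "\<dots> \<le> integral {-pi..pi} (\<lambda>y. ?h y + 2 * ?h (y + 2 * \<eta>) + 2 * m * ?d y)"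
    by (rule integral_le) (auto intro!: integrable_continuous_real continuous_intros cf ch chs cd pt)
  also have "\<dots> = integral {-pi..pi} ?h + 2 * integral {-pi..pi} (\<lambda>y. ?h (y + 2 * \<eta>))
      + 2 * m * integral {-pi..pi} ?d"
    by (subst Henstock_Kurzweil_Integration.integral_add,
        (intro integrable_continuous_real continuous_intros ch chs cd)+)+ simp
  \<comment> \<open>The translated weighted mass equals the original one, hence the factor 3 = 1 +
    2; the factor 8 is 2 times the square of the shift \<open>2 * \<eta>\<close> in units of
    \<open>\<eta>\<close>.\<close>
  also have "integral {-pi..pi} (\<lambda>y. ?h (y + 2 * \<eta>)) = integral {-pi..pi} ?h"
    by (rule integral_periodic_shift[OF _ ch]) (use per W(2) \<eta> in \<open>auto simp: periodic_def\<close>)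
  also have "2 * m * integral {-pi..pi} ?d
      \<le> 2 * m * ((2 * \<eta>)\<^sup>2 * integral {-pi..pi} (\<lambda>y. (norm (f' y))\<^sup>2))"
    using integral_norm_increment_sq_le[OF der cont periodic_vector_derivative[OF per der], of "2 * \<eta>"] \<eta> m
    by (intro mult_left_mono) auto
  finally show ?thesis by (simp add: power_mult_distrib algebra_simps)
qed

section \<open>Integration by parts and time derivatives of integrals\<close>

lemma has_real_derivative_inner:
  fixes u v :: "real \<Rightarrow> 'a::real_inner"
  assumes "(u has_vector_derivative u') (at y within S)" "(v has_vector_derivative v') (at y within S)"
  shows "((\<lambda>y. inner (u y) (v y)) has_real_derivative inner (u y) v' + inner u' (v y)) (at y within S)"
  using bounded_bilinear.has_vector_derivative[OF bounded_bilinear_inner assms]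
  by (simp add: has_real_derivative_iff_has_vector_derivative)

text \<open>The form in which all integrations by parts are made: the total derivative
  \<open>h'\<close> is guessed in advance, and what remains is a pointwise identity that algebra can
  check.\<close>

lemma integral_eq_mod_periodic_deriv:
  fixes X Y h :: "real \<Rightarrow> real"
  assumes "periodic h" "\<And>y. (h has_real_derivative h' y) (at y)"
    and "continuous_on {-pi..pi} Y" "\<And>y. X y = Y y + h' y"
  shows "integral {-pi..pi} X = integral {-pi..pi} Y"
proof -
  have "(Y has_integral integral {-pi..pi} Y) {-pi..pi}"
    by (rule integrable_integral[OF integrable_continuous_real[OF assms(3)]])
  note has_integral_add[OF this periodic_has_integral_deriv[OF assms(1)
      assms(2)[unfolded has_real_derivative_iff_has_vector_derivative]]]
  moreover have "X = (\<lambda>y. Y y + h' y)" by (intro ext) (rule assms(4))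
  ultimately show ?thesis by (simp add: integral_unique)
qed

lemma jointly_cont_compose:
  assumes "jointly_cont S h" "continuous_on A a" "continuous_on A b" "\<And>x. x \<in> A \<Longrightarrow> a x \<in> S"
  shows "continuous_on A (\<lambda>x. h (a x) (b x))"
  using continuous_on_compose2[OF assms(1)[unfolded jointly_cont_def], of A "\<lambda>x. (a x, b x)"] assms(2-)
  by (auto intro!: continuous_intros)

lemma jointly_contI:
  assumes "continuous_on (S \<times> UNIV) (\<lambda>p. h (fst p) (snd p))"
  shows "jointly_cont S h"
  using assms by (simp add: jointly_cont_def split_beta)

lemma has_real_derivative_integral_param:
  fixes h ht :: "real \<Rightarrow> real \<Rightarrow> real"
  assumes "\<And>t y. t \<in> S \<Longrightarrow> ((\<lambda>s. h s y) has_real_derivative ht t y) (at t within S)"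
    and "jointly_cont S h" "jointly_cont S ht" "convex S" "t \<in> S"
  shows "((\<lambda>s. integral {a..b} (h s)) has_real_derivative integral {a..b} (ht t)) (at t within S)"
proof -
  have "((\<lambda>s. integral (cbox a b) (h s)) has_real_derivative integral (cbox a b) (ht t)) (at t within S)"
    using assms(4,5)
    by (intro leibniz_rule_field_derivative[where U = S] integrable_continuous assms(1))
       (auto simp: split_beta intro!: jointly_cont_compose[OF assms(2)] jointly_cont_compose[OF assms(3)]
          continuous_intros)
  then show ?thesis by simp
qed

text \<open>
  The point of this lemma is that \<open>m\<close> need not be differentiable in time: it is what makes the
  time derivative of \<open>\<parallel>\<partial>\<^sub>y g\<parallel>\<^sup>2\<close> available without any assumption on the mixed derivative of \<open>g\<close>.
\<close>

lemma has_real_derivative_integral_increment: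
  fixes a a' m :: "real \<Rightarrow> real \<Rightarrow> 'a::euclidean_space"
  assumes der: "\<And>t y. t \<in> S \<Longrightarrow> ((\<lambda>s. a s y) has_vector_derivative a' t y) (at t within S)"
    and a': "jointly_cont S a'" and m: "jointly_cont S m" and S: "convex S" and t: "t \<in> S"
  shows "((\<lambda>s. integral {c..d} (\<lambda>y. inner (a s y - a t y) (m s y))) has_real_derivative
    integral {c..d} (\<lambda>y. inner (a' t y) (m t y))) (at t within S)"
proof -
  have seg: "t + \<theta> * (s - t) \<in> S" if "s \<in> S" "\<theta> \<in> {0..1}" for s \<theta>
    using convexD_alt[OF S t that(1), of \<theta>] that(2) by (simp add: algebra_simps)
  \<comment> \<open>\<open>Q s\<close> is the difference quotient written as an average of
    \<open>a'\<close> over the segment from \<open>t\<close> to \<open>s\<close>. Unlike the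
    quotient it makes sense at \<open>s = t\<close>, where it equals \<open>a' t\<close>, and it
    inherits joint continuity.\<close>
  define Q where "Q s y = integral {0..1} (\<lambda>\<theta>. a' (t + \<theta> * (s - t)) y)" for s y
  have incr: "a s y - a t y = (s - t) *\<^sub>R Q s y" if s: "s \<in> S" for s y
  proof -
    have 1: "((\<lambda>\<theta>. t + \<theta> * (s - t)) has_vector_derivative (s - t)) (at \<theta> within {0..1})" for \<theta>
      by (simp flip: has_real_derivative_iff_has_vector_derivative)
         (auto intro!: derivative_eq_intros)
    have "((\<lambda>\<theta>. a (t + \<theta> * (s - t)) y) has_vector_derivative (s - t) *\<^sub>R a' (t + \<theta> * (s - t)) y)
        (at \<theta> within {0..1})" if "\<theta> \<in> {0..1}" for \<theta>
      using vector_diff_chain_within[OF 1, of "\<lambda>s. a s y" "a' (t + \<theta> * (s - t)) y" \<theta>]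
        has_vector_derivative_within_subset[OF der[OF seg[OF s that]]] seg[OF s]
      by (auto simp: o_def image_subset_iff)
    then have "((\<lambda>\<theta>. (s - t) *\<^sub>R a' (t + \<theta> * (s - t)) y) has_integral a s y - a t y) {0..1}"
      using fundamental_theorem_of_calculus[of 0 1 "\<lambda>\<theta>. a (t + \<theta> * (s - t)) y"] by simp
    then show ?thesis unfolding Q_def by (metis integral_cmul integral_unique)
  qed
  have Qc: "continuous_on (S \<times> UNIV) (\<lambda>p. Q (fst p) (snd p))"
    unfolding Q_def
    using integral_continuous_on_param[of "S \<times> UNIV" 0 1 "\<lambda>p \<theta>. a' (t + \<theta> * (fst p - t)) (snd p)"]
    by (simp add: split_beta) (rule meta_mp, assumption,
        auto intro!: jointly_cont_compose[OF a'] continuous_intros seg simp: split_beta)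
  \<comment> \<open>For \<open>s\<close> different from \<open>t\<close>, \<open>R s\<close> is the
    difference quotient of the integral in question, which vanishes at \<open>s = t\<close>;
    continuity of \<open>R\<close> is therefore the differentiability claim.\<close>
  define R where "R s = integral (cbox c d) (\<lambda>y. inner (Q s y) (m s y))" for s
  have "continuous_on S R"
    unfolding R_def
    by (rule integral_continuous_on_param)
       (auto simp: split_beta intro!: continuous_intros jointly_cont_compose[OF m]
          jointly_cont_compose[OF jointly_contI[OF Qc]])
  then have R: "(R \<longlongrightarrow> R t) (at t within S)"
    using t by (simp add: continuous_on_def)
  have eq: "integral {c..d} (\<lambda>y. inner (a s y - a t y) (m s y)) = (s - t) * R s" if "s \<in> S" for s
    using incr[OF that] by (simp add: R_def)
  have "a' t y = Q t y" for y by (simp add: Q_def)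
  then have Rt: "integral {c..d} (\<lambda>y. inner (a' t y) (m t y)) = R t" by (simp add: R_def)
  show ?thesis
    unfolding has_field_derivative_iff Rt
    by (rule Lim_transform_eventually[OF R])
       (auto simp: eventually_at_filter eq t)
qed

section \<open>Energy identities for a Fourier mode\<close>

text \<open>The regularity is that of one mode of a classical solution: one time derivative and two
  \<open>y\<close>-derivatives, but no mixed derivative of \<open>g\<close>. The reference flow
  enters through \<open>Uy\<close>, with \<open>Uyy\<close> and \<open>Uty\<close> its derivatives
  in \<open>y\<close> and \<open>t\<close>.\<close>

locale shear_mode =
  fixes T k \<nu> \<sigma> :: real
    and V Vy Uy Uyy Uty :: "real \<Rightarrow> real \<Rightarrow> real"
    and g gt gy gyy :: "real \<Rightarrow> real \<Rightarrow> complex"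
  assumes g_t: "t \<in> {0..T} \<Longrightarrow> ((\<lambda>s. g s y) has_vector_derivative gt t y) (at t within {0..T})"
    and g_y: "t \<in> {0..T} \<Longrightarrow> (g t has_vector_derivative gy t y) (at y)"
    and gy_y: "t \<in> {0..T} \<Longrightarrow> (gy t has_vector_derivative gyy t y) (at y)"
    and Uy_t: "t \<in> {0..T} \<Longrightarrow> ((\<lambda>s. Uy s y) has_real_derivative Uty t y) (at t within {0..T})"
    and Uy_y: "t \<in> {0..T} \<Longrightarrow> (Uy t has_real_derivative Uyy t y) (at y)"
    and V_y: "t \<in> {0..T} \<Longrightarrow> (V t has_real_derivative Vy t y) (at y)"
    and periodic_g: "t \<in> {0..T} \<Longrightarrow> periodic (g t)"
    and periodic_Uy: "t \<in> {0..T} \<Longrightarrow> periodic (Uy t)"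
    and periodic_V: "t \<in> {0..T} \<Longrightarrow> periodic (V t)"
    and cont_g: "jointly_cont {0..T} g" "jointly_cont {0..T} gt" "jointly_cont {0..T} gy" "jointly_cont {0..T} gyy"
    and cont_U: "jointly_cont {0..T} Uy" "jointly_cont {0..T} Uyy" "jointly_cont {0..T} Uty"
    and cont_V: "jointly_cont {0..T} V" "jointly_cont {0..T} Vy"
    and g_eq: "t \<in> {0..T} \<Longrightarrow> gt t y + \<i> * of_real (k * V t y) * g t y
      = of_real \<nu> * gyy t y - of_real (\<sigma> * \<nu> * k\<^sup>2) * g t y"
begin

lemmas conts = cont_g[THEN jointly_cont_compose] cont_U[THEN jointly_cont_compose]
  cont_V[THEN jointly_cont_compose]

lemma gt_eq:
  assumes "t \<in> {0..T}"
  shows "gt t y = of_real \<nu> * gyy t y - \<i> * of_real (k * V t y) * g t y - of_real (\<sigma> * \<nu> * k\<^sup>2) * g t y"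
  using g_eq[OF assms, of y] by (simp add: algebra_simps)

lemma periodic_gy: "t \<in> {0..T} \<Longrightarrow> periodic (gy t)"
  using periodic_vector_derivative[OF periodic_g g_y] .

text \<open>Densities of the four terms of the functional. \<open>inner\<close> is the real inner
  product on the complex plane, so multiplication by \<open>\<i>\<close> is skew:
  \<open>inner (\<i> * z) z = 0\<close>.\<close>

definition "eA t y = (norm (g t y))\<^sup>2"
definition "eB t y = (norm (gy t y))\<^sup>2"
definition "eG t y = Uy t y * inner (\<i> * g t y) (gy t y)"
definition "eE t y = (Uy t y)\<^sup>2 * (norm (g t y))\<^sup>2"

text \<open>
  Densities of the time derivatives of the integrals of \<open>eA\<close>, \<open>eB\<close>, \<open>eG\<close>, \<open>eE\<close>, normalised by
  removing \<open>y\<close>-derivatives of periodic functions.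
\<close>

definition "dA t y = - 2 * \<nu> * (norm (gy t y))\<^sup>2 - 2 * \<sigma> * \<nu> * k\<^sup>2 * eA t y"
definition "dB t y = - 2 * \<nu> * (norm (gyy t y))\<^sup>2 - 2 * k * Vy t y * inner (\<i> * g t y) (gy t y)
  - 2 * \<sigma> * \<nu> * k\<^sup>2 * eB t y"
definition "dG t y = Uty t y * inner (\<i> * g t y) (gy t y) + 2 * \<nu> * Uy t y * inner (\<i> * gyy t y) (gy t y)
  - \<nu> * Uyy t y * inner (\<i> * g t y) (gyy t y) - k * Uy t y * Vy t y * (norm (g t y))\<^sup>2
  - 2 * \<sigma> * \<nu> * k\<^sup>2 * eG t y"
definition "dE t y = 2 * Uy t y * Uty t y * (norm (g t y))\<^sup>2 - 2 * \<nu> * (Uy t y)\<^sup>2 * (norm (gy t y))\<^sup>2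
  - 4 * \<nu> * Uy t y * Uyy t y * inner (g t y) (gy t y) - 2 * \<sigma> * \<nu> * k\<^sup>2 * eE t y"

lemmas e_defs = eA_def eB_def eG_def eE_def
lemmas d_defs = dA_def dB_def dG_def dE_def

lemma continuous_densities:
  assumes "t \<in> {0..T}"
  shows "continuous_on S (eA t)" "continuous_on S (eB t)" "continuous_on S (eG t)" "continuous_on S (eE t)"
    "continuous_on S (dA t)" "continuous_on S (dB t)" "continuous_on S (dG t)" "continuous_on S (dE t)"
  using assms by (auto simp: e_defs[abs_def] d_defs[abs_def] intro!: continuous_intros conts)

text \<open>Transport drops out pointwise, since \<open>\<i> * g\<close> is orthogonal to
  \<open>g\<close>; removing the total derivative of \<open>2 * \<nu> * inner g gy\<close> turns the
  \<open>gyy\<close> term into dissipation.\<close>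

lemma A_deriv:
  assumes t: "t \<in> {0..T}"
  shows "((\<lambda>t. integral {-pi..pi} (eA t)) has_real_derivative integral {-pi..pi} (dA t)) (at t within {0..T})"
proof -
  have "((\<lambda>t. integral {-pi..pi} (eA t)) has_real_derivative
      integral {-pi..pi} (\<lambda>y. 2 * inner (g t y) (gt t y))) (at t within {0..T})"
  proof (rule has_real_derivative_integral_param)
    show "((\<lambda>s. eA s y) has_real_derivative 2 * inner (g t y) (gt t y)) (at t within {0..T})"
      if "t \<in> {0..T}" for t y
      using has_real_derivative_inner[OF g_t[OF that] g_t[OF that], of y y]
      by (simp add: eA_def power2_norm_eq_inner inner_commute)
  qed (use t in \<open>auto simp: e_defs intro!: jointly_contI continuous_intros conts\<close>)
  also have "integral {-pi..pi} (\<lambda>y. 2 * inner (g t y) (gt t y)) = integral {-pi..pi} (dA t)"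
  proof (rule integral_eq_mod_periodic_deriv[where h = "\<lambda>y. 2 * \<nu> * inner (g t y) (gy t y)"])
    show "((\<lambda>y. 2 * \<nu> * inner (g t y) (gy t y)) has_real_derivative
        2 * \<nu> * (inner (g t y) (gyy t y) + inner (gy t y) (gy t y))) (at y)" for y
      by (rule DERIV_cmult[OF has_real_derivative_inner[OF g_y[OF t] gy_y[OF t]]])
    show "2 * inner (g t y) (gt t y) = dA t y + 2 * \<nu> * (inner (g t y) (gyy t y) + inner (gy t y) (gy t y))" for y
      unfolding d_defs e_defs cmod_power2
      by (simp add: gt_eq[OF t] inner_complex_def algebra_simps power2_eq_square)
  qed (use periodic_g[OF t] periodic_gy[OF t] continuous_densities[OF t] in \<open>auto simp: periodic_def\<close>)
  finally show ?thesis .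
qed

text \<open>Transport drops out as for the mass. Moving a derivative of \<open>gyy\<close> past the
  weight differentiates the square of \<open>Uy\<close>, which is the origin of the term with
  \<open>Uyy\<close>.\<close>

lemma E_deriv:
  assumes t: "t \<in> {0..T}"
  shows "((\<lambda>t. integral {-pi..pi} (eE t)) has_real_derivative integral {-pi..pi} (dE t)) (at t within {0..T})"
proof -
  let ?D = "\<lambda>t y. 2 * Uy t y * Uty t y * inner (g t y) (g t y) + (Uy t y)\<^sup>2 * (2 * inner (g t y) (gt t y))"
  have "((\<lambda>t. integral {-pi..pi} (eE t)) has_real_derivative
      integral {-pi..pi} (?D t)) (at t within {0..T})"
  proof (rule has_real_derivative_integral_param)
    show "((\<lambda>s. eE s y) has_real_derivative ?D t y) (at t within {0..T})" if "t \<in> {0..T}" for t y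
      unfolding eE_def power2_norm_eq_inner
      by (rule derivative_eq_intros has_real_derivative_inner g_t Uy_t that refl)+
         (simp add: inner_commute)
  qed (use t in \<open>auto simp: e_defs intro!: jointly_contI continuous_intros conts\<close>)
  also have "integral {-pi..pi} (?D t) = integral {-pi..pi} (dE t)"
  proof (rule integral_eq_mod_periodic_deriv[where h = "\<lambda>y. 2 * \<nu> * ((Uy t y)\<^sup>2 * inner (g t y) (gy t y))"])
    show "((\<lambda>y. 2 * \<nu> * ((Uy t y)\<^sup>2 * inner (g t y) (gy t y))) has_real_derivative
        2 * \<nu> * (2 * Uy t y * Uyy t y * inner (g t y) (gy t y)
          + (Uy t y)\<^sup>2 * (inner (g t y) (gyy t y) + inner (gy t y) (gy t y)))) (at y)" for y
      by (rule derivative_eq_intros has_real_derivative_inner g_y gy_y Uy_y t refl)+ simp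
    show "?D t y = dE t y + 2 * \<nu> * (2 * Uy t y * Uyy t y * inner (g t y) (gy t y)
          + (Uy t y)\<^sup>2 * (inner (g t y) (gyy t y) + inner (gy t y) (gy t y)))" for y
      unfolding d_defs e_defs cmod_power2
      by (simp add: gt_eq[OF t] inner_complex_def algebra_simps power2_eq_square)
  qed (use periodic_g[OF t] periodic_gy[OF t] periodic_Uy[OF t] continuous_densities[OF t]
      in \<open>auto simp: periodic_def\<close>)
  finally show ?thesis .
qed

text \<open>The difference of the energies at \<open>s\<close> and \<open>t\<close> is the integral
  of \<open>inner (gy s - gy t) (gy s + gy t)\<close>. Integration by parts leaves a time increment
  of \<open>g\<close> itself, paired with second derivatives that need only be continuous in
  time.\<close>

lemma B_deriv:
  assumes t: "t \<in> {0..T}"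
  shows "((\<lambda>t. integral {-pi..pi} (eB t)) has_real_derivative integral {-pi..pi} (dB t)) (at t within {0..T})"
proof -
  let ?I = "\<lambda>s. integral {-pi..pi} (\<lambda>y. inner (g s y - g t y) (- (gyy s y + gyy t y)))"
  have incr: "integral {-pi..pi} (eB s) = ?I s + integral {-pi..pi} (eB t)" if s: "s \<in> {0..T}" for s
  proof -
    have "integral {-pi..pi} (eB s) =
        integral {-pi..pi} (\<lambda>y. inner (g s y - g t y) (- (gyy s y + gyy t y)) + eB t y)"
    proof (rule integral_eq_mod_periodic_deriv[where h = "\<lambda>y. inner (g s y - g t y) (gy s y + gy t y)"])
      show "((\<lambda>y. inner (g s y - g t y) (gy s y + gy t y)) has_real_derivative
          inner (g s y - g t y) (gyy s y + gyy t y) + inner (gy s y - gy t y) (gy s y + gy t y)) (at y)" for y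
        by (intro has_real_derivative_inner has_vector_derivative_diff has_vector_derivative_add
            g_y gy_y s t)
      show "eB s y = inner (g s y - g t y) (- (gyy s y + gyy t y)) + eB t y +
        (inner (g s y - g t y) (gyy s y + gyy t y) + inner (gy s y - gy t y) (gy s y + gy t y))" for y
        unfolding e_defs cmod_power2
        by (simp add: inner_complex_def algebra_simps power2_eq_square)
    qed (use s t periodic_g[OF t] periodic_gy[OF t] periodic_g[OF s] periodic_gy[OF s]
        in \<open>auto simp: periodic_def intro!: continuous_intros conts continuous_densities\<close>)
    also have "\<dots> = ?I s + integral {-pi..pi} (eB t)"
      by (rule Henstock_Kurzweil_Integration.integral_add)
         (use s t in \<open>auto intro!: integrable_continuous_real continuous_intros conts continuous_densities\<close>)
    finally show ?thesis .
  qed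
  have "(?I has_real_derivative integral {-pi..pi} (\<lambda>y. inner (gt t y) (- (gyy t y + gyy t y))))
      (at t within {0..T})"
    by (rule has_real_derivative_integral_increment)
       (use t in \<open>auto intro!: g_t jointly_contI continuous_intros conts\<close>)
  then have "((\<lambda>s. ?I s + integral {-pi..pi} (eB t)) has_real_derivative
      integral {-pi..pi} (\<lambda>y. inner (gt t y) (- (gyy t y + gyy t y)))) (at t within {0..T})"
    by (auto intro!: derivative_eq_intros)
  then have "((\<lambda>s. integral {-pi..pi} (eB s)) has_real_derivative
      integral {-pi..pi} (\<lambda>y. inner (gt t y) (- (gyy t y + gyy t y)))) (at t within {0..T})"
    by (rule has_field_derivative_transform_within[OF _ zero_less_one t]) (simp add: incr)
  also have "integral {-pi..pi} (\<lambda>y. inner (gt t y) (- (gyy t y + gyy t y))) = integral {-pi..pi} (dB t)"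
  \<comment> \<open>The first part of \<open>h\<close> trades \<open>V\<close> for
    \<open>Vy\<close>, which is the commutator of the \<open>y\<close>-derivative with transport;
    the second part treats the term with \<open>\<sigma>\<close>.\<close>
  proof (rule integral_eq_mod_periodic_deriv[where h =
        "\<lambda>y. 2 * k * (V t y * inner (\<i> * g t y) (gy t y)) + 2 * \<sigma> * \<nu> * k\<^sup>2 * inner (g t y) (gy t y)"])
    show "((\<lambda>y. 2 * k * (V t y * inner (\<i> * g t y) (gy t y)) + 2 * \<sigma> * \<nu> * k\<^sup>2 * inner (g t y) (gy t y))
       has_real_derivative 2 * k * (Vy t y * inner (\<i> * g t y) (gy t y) + V t y *
         (inner (\<i> * g t y) (gyy t y) + inner (\<i> * gy t y) (gy t y)))
        + 2 * \<sigma> * \<nu> * k\<^sup>2 * (inner (g t y) (gyy t y) + inner (gy t y) (gy t y))) (at y)" for y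
      by (rule derivative_eq_intros has_real_derivative_inner has_vector_derivative_mult_right
          g_y gy_y V_y t refl)+ simp
    show "inner (gt t y) (- (gyy t y + gyy t y)) = dB t y +
        (2 * k * (Vy t y * inner (\<i> * g t y) (gy t y) + V t y *
         (inner (\<i> * g t y) (gyy t y) + inner (\<i> * gy t y) (gy t y)))
        + 2 * \<sigma> * \<nu> * k\<^sup>2 * (inner (g t y) (gyy t y) + inner (gy t y) (gy t y)))" for y
      unfolding d_defs e_defs cmod_power2
      by (simp add: gt_eq[OF t] inner_complex_def algebra_simps power2_eq_square)
  qed (use periodic_g[OF t] periodic_gy[OF t] periodic_V[OF t] continuous_densities[OF t]
      in \<open>auto simp: periodic_def\<close>)
  finally show ?thesis .
qed

text \<open>The same device for the mixed term: its increment splits by a product rule into one of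
  \<open>Uy * \<i> * g\<close>, which is differentiable in time, and one of \<open>gy\<close>, which
  is moved onto \<open>g\<close> by parts. Hence \<open>?I\<close> and \<open>?J\<close>.\<close>

lemma G_deriv:
  assumes t: "t \<in> {0..T}"
  shows "((\<lambda>t. integral {-pi..pi} (eG t)) has_real_derivative integral {-pi..pi} (dG t)) (at t within {0..T})"
proof -
  let ?a = "\<lambda>s y. Uy s y *\<^sub>R (\<i> * g s y)"
  let ?at = "\<lambda>s y. Uy s y *\<^sub>R (\<i> * gt s y) + Uty s y *\<^sub>R (\<i> * g s y)"
  let ?ay = "\<lambda>s y. Uy s y *\<^sub>R (\<i> * gy s y) + Uyy s y *\<^sub>R (\<i> * g s y)"
  let ?I = "\<lambda>s. integral {-pi..pi} (\<lambda>y. inner (?a s y - ?a t y) (gy s y))"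
  let ?J = "\<lambda>s. integral {-pi..pi} (\<lambda>y. inner (g s y - g t y) (- ?ay t y))"
  have incr: "integral {-pi..pi} (eG s) = ?I s + ?J s + integral {-pi..pi} (eG t)" if s: "s \<in> {0..T}" for s
  proof -
    have "integral {-pi..pi} (eG s) = integral {-pi..pi} (\<lambda>y.
        inner (?a s y - ?a t y) (gy s y) + inner (g s y - g t y) (- ?ay t y) + eG t y)"
    proof (rule integral_eq_mod_periodic_deriv[where h = "\<lambda>y. inner (?a t y) (g s y - g t y)"])
      show "((\<lambda>y. inner (?a t y) (g s y - g t y)) has_real_derivative
          inner (?a t y) (gy s y - gy t y) + inner (?ay t y) (g s y - g t y)) (at y)" for y
        by (intro has_real_derivative_inner has_vector_derivative_diff has_vector_derivative_scaleR
            has_vector_derivative_mult_right g_y gy_y Uy_y s t)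
      show "eG s y = inner (?a s y - ?a t y) (gy s y) + inner (g s y - g t y) (- ?ay t y) + eG t y +
          (inner (?a t y) (gy s y - gy t y) + inner (?ay t y) (g s y - g t y))" for y
        by (simp add: e_defs inner_complex_def algebra_simps)
    qed (use s t periodic_g[OF t] periodic_gy[OF t] periodic_g[OF s] periodic_Uy[OF t]
        in \<open>auto simp: periodic_def intro!: continuous_intros conts continuous_densities\<close>)
    also have "\<dots> = ?I s + ?J s + integral {-pi..pi} (eG t)"
      by (subst Henstock_Kurzweil_Integration.integral_add;
          (subst Henstock_Kurzweil_Integration.integral_add)?)
         (use s t in \<open>auto intro!: integrable_continuous_real continuous_intros conts continuous_densities\<close>)
    finally show ?thesis .
  qed
  have I: "(?I has_real_derivative integral {-pi..pi} (\<lambda>y. inner (?at t y) (gy t y))) (at t within {0..T})"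
  proof (rule has_real_derivative_integral_increment)
    show "((\<lambda>s. ?a s y) has_vector_derivative ?at t y) (at t within {0..T})" if "t \<in> {0..T}" for t y
      by (intro has_vector_derivative_scaleR has_vector_derivative_mult_right g_t Uy_t that)
  qed (use t in \<open>auto intro!: jointly_contI continuous_intros conts\<close>)
  have J: "(?J has_real_derivative integral {-pi..pi} (\<lambda>y. inner (gt t y) (- ?ay t y))) (at t within {0..T})"
    by (rule has_real_derivative_integral_increment)
       (use t in \<open>auto intro!: g_t jointly_contI continuous_intros conts\<close>)
  have "((\<lambda>s. ?I s + ?J s + integral {-pi..pi} (eG t)) has_real_derivative
      integral {-pi..pi} (\<lambda>y. inner (?at t y) (gy t y)) + integral {-pi..pi} (\<lambda>y. inner (gt t y) (- ?ay t y)))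
      (at t within {0..T})"
    using I J by (auto intro!: derivative_eq_intros)
  then have "((\<lambda>s. integral {-pi..pi} (eG s)) has_real_derivative
      integral {-pi..pi} (\<lambda>y. inner (?at t y) (gy t y)) + integral {-pi..pi} (\<lambda>y. inner (gt t y) (- ?ay t y)))
      (at t within {0..T})"
    by (rule has_field_derivative_transform_within[OF _ zero_less_one t]) (simp add: incr)
  also have "integral {-pi..pi} (\<lambda>y. inner (?at t y) (gy t y)) + integral {-pi..pi} (\<lambda>y. inner (gt t y) (- ?ay t y))
      = integral {-pi..pi} (\<lambda>y. inner (?at t y) (gy t y) + inner (gt t y) (- ?ay t y))"
    by (rule Henstock_Kurzweil_Integration.integral_add[symmetric])
       (use t in \<open>auto intro!: integrable_continuous_real continuous_intros conts\<close>)
  also have "\<dots> = integral {-pi..pi} (dG t)"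
  \<comment> \<open>Both parts contribute terms with undifferentiated \<open>V\<close>; removing
    this total derivative leaves \<open>- k * Uy * Vy * |g|^2\<close>, the weighted damping of the
    mass.\<close>
  proof (rule integral_eq_mod_periodic_deriv[where h = "\<lambda>y. k * (Uy t y * V t y * inner (g t y) (g t y))"])
    show "((\<lambda>y. k * (Uy t y * V t y * inner (g t y) (g t y))) has_real_derivative
        k * ((Uy t y * Vy t y + Uyy t y * V t y) * inner (g t y) (g t y)
          + Uy t y * V t y * (2 * inner (g t y) (gy t y)))) (at y)" for y
      by (rule derivative_eq_intros has_real_derivative_inner g_y Uy_y V_y t refl)+
         (simp add: algebra_simps inner_commute)
    show "inner (?at t y) (gy t y) + inner (gt t y) (- ?ay t y) = dG t y +
        k * ((Uy t y * Vy t y + Uyy t y * V t y) * inner (g t y) (g t y)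
          + Uy t y * V t y * (2 * inner (g t y) (gy t y)))" for y
      unfolding d_defs e_defs cmod_power2
      by (simp add: gt_eq[OF t] inner_complex_def algebra_simps power2_eq_square)
  qed (use periodic_g[OF t] periodic_Uy[OF t] periodic_V[OF t] continuous_densities[OF t]
      in \<open>auto simp: periodic_def\<close>)
  finally show ?thesis .
qed

end

section \<open>Hypocoercive decay\<close>

text \<open>Here \<open>a\<close>, \<open>b\<close>, \<open>c\<close> stand for the sizes of
  \<open>g\<close>, \<open>gy\<close>, \<open>gyy\<close> and \<open>w\<close> for that of
  \<open>Uy\<close>, in units of the critical layer. Young's inequality absorbs the indefinite terms
  into the four negative ones. The remaining multiples of \<open>\<tau>\<^sup>2 * a\<^sup>2\<close>
  cannot be absorbed pointwise and wait for the spectral inequality.\<close>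

lemma hypocoercive_quadratic_bound:
  fixes a b c w \<tau> \<alpha> \<beta> \<gamma> L K :: real
  assumes nn: "0 \<le> a" "0 \<le> b" "0 \<le> c" "0 \<le> w" "0 \<le> \<tau>" "\<tau> \<le> 1"
    and pos: "0 < \<alpha>" "0 < \<beta>" "0 < \<gamma>" "0 < L" "0 \<le> K"
    and \<alpha>: "\<alpha> \<le> 1/4" and \<gamma>: "12 * \<gamma> * L \<le> \<beta>" and \<beta>: "2 * \<beta>\<^sup>2 \<le> \<alpha> * \<gamma>"
    and cross: "4 * L * (\<alpha> * L + 2 * \<beta> + 2 * \<gamma> * K)\<^sup>2 \<le> \<beta>"
  shows "- b\<^sup>2 + \<alpha> / 2 * b\<^sup>2 - \<alpha> * \<tau> * c\<^sup>2 + \<alpha> * \<tau> * L * w * a * b + 2 * \<beta> * \<tau> * w * a * b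
      - \<beta> / L * \<tau>\<^sup>2 * w\<^sup>2 * a\<^sup>2 + \<beta> * \<tau>\<^sup>2 * a * b + 2 * \<beta> * \<tau>\<^sup>2 * w * b * c + \<beta> * \<tau>\<^sup>2 * K * a * c
      + 3 / 2 * \<gamma> * \<tau>\<^sup>2 * w\<^sup>2 * a\<^sup>2 + \<gamma> * \<tau> ^ 3 * w * a\<^sup>2 + 2 * \<gamma> * \<tau> ^ 3 * K * w * a * b
      - \<gamma> * \<tau> ^ 3 * w\<^sup>2 * b\<^sup>2
    \<le> - (1/2) * b\<^sup>2 - \<beta> / (2 * L) * (\<tau> * w * a)\<^sup>2
      + (2 * \<beta>\<^sup>2 + \<beta>\<^sup>2 * K\<^sup>2 / (2 * \<alpha>) + \<gamma> / 2) * (\<tau>\<^sup>2 * a\<^sup>2)"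
proof -
  define x where "x = \<tau> * w * a"
  define S where "S = \<alpha> * L + 2 * \<beta> + 2 * \<gamma> * K"
  have x: "0 \<le> x" using nn by (simp add: x_def)
  have \<tau>2: "\<tau>\<^sup>2 \<le> 1" "0 \<le> \<tau>\<^sup>2" using nn by (auto simp: power_le_one)
  have young: "u * v \<le> e * u\<^sup>2 + v\<^sup>2 / (4 * e)" if "0 < e" for u v e :: real
  proof -
    have "0 \<le> (2 * e * u - v)\<^sup>2 / (4 * e)" using that by simp
    also have "\<dots> = e * u\<^sup>2 + v\<^sup>2 / (4 * e) - u * v"
      using that by (simp add: field_simps power2_eq_square)
    finally show ?thesis by simp
  qed
  \<comment> \<open>Budget: \<open>t1\<close>, \<open>t2\<close>, \<open>t3\<close> spend 1/8, 1/4,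
    1/8 of \<open>b\<^sup>2\<close>; \<open>t2\<close>, \<open>t6\<close>, \<open>t7\<close> spend
    1/4, 1/8, 1/8 of \<open>\<beta> / L * x\<^sup>2\<close>; \<open>t4\<close> and \<open>t5\<close>
    spend half each of the \<open>c\<^sup>2\<close> term, and \<open>t4\<close> also the whole last
    negative term. \<open>t8\<close> feeds its term into \<open>S * x * b\<close>.\<close>
  have t1: "\<alpha> / 2 * b\<^sup>2 \<le> 1/8 * b\<^sup>2" using \<alpha> by (intro mult_right_mono) auto
  have t2: "S * x * b \<le> 1/4 * b\<^sup>2 + \<beta> / (4 * L) * x\<^sup>2"
  proof -
    have "b * (S * x) \<le> 1/4 * b\<^sup>2 + S\<^sup>2 * x\<^sup>2"
      using young[of "1/4" b "S * x"] by (simp add: power_mult_distrib)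
    also have "S\<^sup>2 \<le> \<beta> / (4 * L)" using cross pos by (simp add: S_def field_simps)
    finally show ?thesis by (simp add: mult.commute mult_right_mono)
  qed
  have t3: "\<beta> * \<tau>\<^sup>2 * a * b \<le> 1/8 * b\<^sup>2 + 2 * \<beta>\<^sup>2 * (\<tau>\<^sup>2 * a\<^sup>2)"
  proof -
    have "b * (\<beta> * \<tau>\<^sup>2 * a) \<le> 1/8 * b\<^sup>2 + 2 * \<beta>\<^sup>2 * (\<tau>\<^sup>2 * (\<tau>\<^sup>2 * a\<^sup>2))"
      using young[of "1/8" b "\<beta> * \<tau>\<^sup>2 * a"] by (simp add: power_mult_distrib power2_eq_square mult_ac)
    also have "2 * \<beta>\<^sup>2 * (\<tau>\<^sup>2 * (\<tau>\<^sup>2 * a\<^sup>2)) \<le> 2 * \<beta>\<^sup>2 * (1 * (\<tau>\<^sup>2 * a\<^sup>2))"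
      by (intro mult_left_mono mult_right_mono \<tau>2) auto
    finally show ?thesis by (simp add: mult_ac)
  qed
  have t4: "2 * \<beta> * \<tau>\<^sup>2 * w * b * c \<le> \<alpha> * \<tau> / 2 * c\<^sup>2 + \<gamma> * \<tau> ^ 3 * w\<^sup>2 * b\<^sup>2"
  proof -
    have "c * (2 * \<beta> * \<tau> * w * b) \<le> \<alpha> / 2 * c\<^sup>2 + 2 * \<beta>\<^sup>2 / \<alpha> * (\<tau>\<^sup>2 * w\<^sup>2 * b\<^sup>2)"
      using young[of "\<alpha> / 2" c "2 * \<beta> * \<tau> * w * b"] pos by (simp add: power_mult_distrib field_simps)
    also have "2 * \<beta>\<^sup>2 / \<alpha> \<le> \<gamma>" using \<beta> pos by (simp add: field_simps)
    finally have "c * (2 * \<beta> * \<tau> * w * b) \<le> \<alpha> / 2 * c\<^sup>2 + \<gamma> * (\<tau>\<^sup>2 * w\<^sup>2 * b\<^sup>2)"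
      by (simp add: mult_right_mono)
    from mult_left_mono[OF this nn(5)] show ?thesis
      by (simp add: algebra_simps power2_eq_square power3_eq_cube)
  qed
  have t5: "\<beta> * \<tau>\<^sup>2 * K * a * c \<le> \<alpha> * \<tau> / 2 * c\<^sup>2 + \<beta>\<^sup>2 * K\<^sup>2 / (2 * \<alpha>) * (\<tau>\<^sup>2 * a\<^sup>2)"
  proof -
    have "c * (\<beta> * \<tau> * K * a) \<le> \<alpha> / 2 * c\<^sup>2 + \<beta>\<^sup>2 * K\<^sup>2 / (2 * \<alpha>) * (\<tau>\<^sup>2 * a\<^sup>2)"
      using young[of "\<alpha> / 2" c "\<beta> * \<tau> * K * a"] pos by (simp add: power_mult_distrib field_simps)
    from mult_left_mono[OF this nn(5)]
    have "\<beta> * \<tau>\<^sup>2 * K * a * c \<le> \<alpha> * \<tau> / 2 * c\<^sup>2 + \<tau> * (\<beta>\<^sup>2 * K\<^sup>2 / (2 * \<alpha>) * (\<tau>\<^sup>2 * a\<^sup>2))"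
      by (simp add: algebra_simps power2_eq_square)
    also have "\<tau> * (\<beta>\<^sup>2 * K\<^sup>2 / (2 * \<alpha>) * (\<tau>\<^sup>2 * a\<^sup>2)) \<le> 1 * (\<beta>\<^sup>2 * K\<^sup>2 / (2 * \<alpha>) * (\<tau>\<^sup>2 * a\<^sup>2))"
      using nn pos by (intro mult_right_mono) auto
    finally show ?thesis by simp
  qed
  have g12: "\<gamma> \<le> \<beta> / (12 * L)" using \<gamma> pos by (simp add: field_simps)
  have t6: "3 / 2 * \<gamma> * x\<^sup>2 \<le> \<beta> / (8 * L) * x\<^sup>2"
    using g12 by (intro mult_right_mono) (auto simp: field_simps)
  have t7: "\<gamma> * \<tau>\<^sup>2 * x * a \<le> \<beta> / (8 * L) * x\<^sup>2 + \<gamma> / 2 * (\<tau>\<^sup>2 * a\<^sup>2)"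
  proof -
    have "x * a \<le> x\<^sup>2 / 2 + a\<^sup>2 / 2" using young[of "1/2" x a] by simp
    then have "\<gamma> * \<tau>\<^sup>2 * (x * a) \<le> \<gamma> * \<tau>\<^sup>2 * (x\<^sup>2 / 2 + a\<^sup>2 / 2)"
      using pos by (intro mult_left_mono) auto
    also have "\<dots> = \<gamma> / 2 * (\<tau>\<^sup>2 * x\<^sup>2) + \<gamma> / 2 * (\<tau>\<^sup>2 * a\<^sup>2)" by (simp add: field_simps)
    also have "\<gamma> / 2 * (\<tau>\<^sup>2 * x\<^sup>2) \<le> \<beta> / (8 * L) * x\<^sup>2"
    proof (rule mult_mono)
      have "\<beta> / (12 * L) = 2/3 * (\<beta> / (8 * L))" "0 < \<beta> / (8 * L)" using pos by auto
      then show "\<gamma> / 2 \<le> \<beta> / (8 * L)" using g12 by linarith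
      show "\<tau>\<^sup>2 * x\<^sup>2 \<le> x\<^sup>2" using mult_right_mono[OF \<tau>2(1), of "x\<^sup>2"] by simp
    qed (use pos in auto)
    finally show ?thesis by (simp add: mult_ac)
  qed
  have t8: "2 * \<gamma> * \<tau> ^ 3 * K * w * a * b \<le> 2 * \<gamma> * K * x * b"
  proof -
    have "\<tau>\<^sup>2 * (2 * \<gamma> * K * x * b) \<le> 1 * (2 * \<gamma> * K * x * b)"
      using nn pos x by (intro mult_right_mono \<tau>2) auto
    then show ?thesis by (simp add: x_def mult_ac power2_eq_square power3_eq_cube)
  qed
  have e: "\<alpha> * \<tau> * L * w * a * b + 2 * \<beta> * \<tau> * w * a * b + 2 * \<gamma> * K * x * b = S * x * b"
    "\<beta> / L * \<tau>\<^sup>2 * w\<^sup>2 * a\<^sup>2 = \<beta> / L * x\<^sup>2" "3 / 2 * \<gamma> * \<tau>\<^sup>2 * w\<^sup>2 * a\<^sup>2 = 3 / 2 * \<gamma> * x\<^sup>2"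
    "\<gamma> * \<tau> ^ 3 * w * a\<^sup>2 = \<gamma> * \<tau>\<^sup>2 * x * a"
    by (simp_all add: S_def x_def power_mult_distrib algebra_simps power2_eq_square power3_eq_cube)
  have fr: "\<beta> / L * x\<^sup>2 = 4 * (\<beta> / (4 * L) * x\<^sup>2)" "\<beta> / (2 * L) * x\<^sup>2 = 2 * (\<beta> / (4 * L) * x\<^sup>2)"
    "\<beta> / (8 * L) * x\<^sup>2 = 1/2 * (\<beta> / (4 * L) * x\<^sup>2)" by (auto simp: field_simps)
  have d: "(A + B + C) * X = A * X + B * X + C * X" for A B C X :: real by (simp add: algebra_simps)
  have h: "\<alpha> * \<tau> / 2 * c\<^sup>2 = 1/2 * (\<alpha> * \<tau> * c\<^sup>2)" by simp
  show ?thesis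
    using t1 t2 t3 t4 t5 t6 t7 t8 e unfolding d fr h x_def[symmetric] by linarith
qed

text \<open>With \<open>\<beta> = h * \<alpha>\<close> and \<open>\<gamma> = g * \<beta>\<close> the
  constraints decouple: \<open>12 * \<gamma> * L \<le> \<beta>\<close> bounds \<open>g\<close>,
  \<open>2 * \<beta>\<^sup>2 \<le> \<alpha> * \<gamma>\<close> becomes \<open>2 * h \<le> g\<close>,
  and the last one, divided by \<open>\<beta>\<close>, asks \<open>g\<close> and
  \<open>h * (1 + K\<^sup>2)\<close> to be small against \<open>c / L\<close>. The one with the
  squared sum is quadratic in \<open>\<alpha>\<close> on the left and linear on the right, so a
  small \<open>\<alpha>\<close> settles it.\<close>

lemma hypocoercive_constants:
  fixes L K c :: real
  assumes "1 \<le> L" "0 \<le> K" "0 < c" "c \<le> 1"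
  obtains \<alpha> \<beta> \<gamma> :: real where "0 < \<alpha>" "0 < \<beta>" "0 < \<gamma>" "\<alpha> \<le> 1/4" "\<beta> \<le> 1" "\<gamma> \<le> 1"
    "12 * \<gamma> * L \<le> \<beta>" "2 * \<beta>\<^sup>2 \<le> \<alpha> * \<gamma>" "4 * L * (\<alpha> * L + 2 * \<beta> + 2 * \<gamma> * K)\<^sup>2 \<le> \<beta>"
    "2 * \<beta>\<^sup>2 + \<beta>\<^sup>2 * K\<^sup>2 / (2 * \<alpha>) + \<gamma> / 2 \<le> \<beta> * c / (8 * L)"
proof -
  define m where "m = c / L"
  define g where "g = m / 12"
  define D where "D = 1 + K\<^sup>2"
  define h where "h = m / (24 * D)"
  define S where "S = L + 2 * h + 2 * g * h * K"
  define \<alpha> where "\<alpha> = min (1/4) (h / (4 * L * S\<^sup>2))"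
  have K: "0 < D" unfolding D_def by (smt (verit) zero_le_power2)
  have m: "0 < m" "m \<le> 1" "m * L = c" using assms by (auto simp: m_def)
  have g: "0 < g" "g \<le> 1" "12 * g * L = c" using m by (auto simp: g_def)
  have h24: "24 * h * D = m" using K by (simp add: h_def)
  have h: "0 < h" using m K by (simp add: h_def)
  have hK: "0 \<le> h * K\<^sup>2" using h by simp
  have h24': "24 * h + 24 * (h * K\<^sup>2) = m" using h24 by (simp add: D_def algebra_simps)
  have S: "0 < S" using assms g h by (auto simp: S_def intro!: add_pos_nonneg)
  have \<alpha>: "0 < \<alpha>" "\<alpha> \<le> 1/4" "\<alpha> \<le> h / (4 * L * S\<^sup>2)" using h S assms by (auto simp: \<alpha>_def)
  define \<beta> where "\<beta> = h * \<alpha>"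
  define \<gamma> where "\<gamma> = g * \<beta>"
  have \<beta>: "0 < \<beta>" using h \<alpha> by (simp add: \<beta>_def)
  have h1: "h \<le> 1" using h24' hK m by linarith
  show thesis
  proof
    show "0 < \<alpha>" "\<alpha> \<le> 1/4" "0 < \<beta>" by fact+
    show "0 < \<gamma>" using g \<beta> by (simp add: \<gamma>_def)
    show b1: "\<beta> \<le> 1" unfolding \<beta>_def using h1 \<alpha> h by (intro mult_le_one) auto
    show "\<gamma> \<le> 1" unfolding \<gamma>_def using g b1 \<beta> by (intro mult_le_one) auto
    have "12 * \<gamma> * L = c * \<beta>" using g by (simp add: \<gamma>_def)
    then show "12 * \<gamma> * L \<le> \<beta>" using assms \<beta> by (simp add: mult_left_le_one_le)
    have "2 * h \<le> g" using h24' hK g_def by linarith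
    then have "\<alpha> * \<beta> * (2 * h) \<le> \<alpha> * \<beta> * g" using \<alpha> \<beta> by (intro mult_left_mono) auto
    then show "2 * \<beta>\<^sup>2 \<le> \<alpha> * \<gamma>" by (simp add: \<beta>_def \<gamma>_def power2_eq_square mult_ac)
    have "4 * L * (\<alpha> * L + 2 * \<beta> + 2 * \<gamma> * K)\<^sup>2 = \<alpha> * (4 * L * S\<^sup>2) * \<alpha>"
      by (simp add: \<beta>_def \<gamma>_def S_def algebra_simps power2_eq_square)
    also have "\<dots> \<le> h * \<alpha>"
      using \<alpha> assms S by (intro mult_right_mono) (auto simp: field_simps)
    finally show "4 * L * (\<alpha> * L + 2 * \<beta> + 2 * \<gamma> * K)\<^sup>2 \<le> \<beta>" by (simp add: \<beta>_def)
    have "2 * \<beta>\<^sup>2 + \<beta>\<^sup>2 * K\<^sup>2 / (2 * \<alpha>) + \<gamma> / 2 = \<beta> * (2 * h * \<alpha> + h * K\<^sup>2 / 2 + g / 2)"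
      using \<alpha> by (simp add: \<beta>_def \<gamma>_def field_simps power2_eq_square)
    also have "\<dots> \<le> \<beta> * (m / 8)"
    proof (rule mult_left_mono)
      have "h * \<alpha> \<le> h * (1/4)" using \<alpha> h by (intro mult_left_mono) auto
      then show "2 * h * \<alpha> + h * K\<^sup>2 / 2 + g / 2 \<le> m / 8"
        using h24' hK h m unfolding g_def by linarith
    qed (use \<beta> in auto)
    finally show "2 * \<beta>\<^sup>2 + \<beta>\<^sup>2 * K\<^sup>2 / (2 * \<alpha>) + \<gamma> / 2 \<le> \<beta> * c / (8 * L)" by (simp add: m_def)
  qed
qed

section \<open>The functional with time-dependent weights and its dissipation\<close>

lemma weighted_inner_le:
  fixes u v :: "'a::real_inner"
  assumes "\<bar>p\<bar> \<le> P"
  shows "p * inner u v \<le> P * norm u * norm v"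
proof -
  have "p * inner u v \<le> \<bar>p\<bar> * \<bar>inner u v\<bar>" by (metis abs_ge_self abs_mult)
  also have "\<dots> \<le> P * (norm u * norm v)"
    using assms by (intro mult_mono Cauchy_Schwarz_ineq2) auto
  finally show ?thesis by (simp add: mult.assoc)
qed

text \<open>
  The natural scales are \<open>\<rho> = (\<nu> * \<bar>k\<bar>) powr (1/2)\<close>, the decay rate, and \<open>q = (\<nu> / \<bar>k\<bar>) powr (1/4)\<close>, the
  width of the critical layer, so that \<open>\<nu> = \<rho> * q\<^sup>2\<close> and \<open>\<bar>k\<bar> = \<rho> / q\<^sup>2\<close>; \<open>s\<close> is the sign of \<open>k\<close>.
\<close>

locale enhanced_shear_mode = shear_mode +
  fixes \<rho> q s L K c :: real
  assumes \<rho>: "0 < \<rho>" and q: "0 < q" and \<nu>_eq: "\<nu> = \<rho> * q\<^sup>2" and k_eq: "k = s * \<rho> / q\<^sup>2"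
    and s: "\<bar>s\<bar> = 1" and \<sigma>: "0 \<le> \<sigma>" and L: "1 \<le> L" and K: "0 \<le> K" and c: "0 < c" "c \<le> 1"
    and Vy_le: "t \<in> {0..T} \<Longrightarrow> \<bar>Vy t y\<bar> \<le> L * \<bar>Uy t y\<bar>"
    and phase: "t \<in> {0..T} \<Longrightarrow> (Uy t y)\<^sup>2 \<le> L * (Uy t y * Vy t y)"
    and Uyy_le: "t \<in> {0..T} \<Longrightarrow> y \<in> {-pi..pi} \<Longrightarrow> \<bar>Uyy t y\<bar> \<le> K"
    and Uty_le: "t \<in> {0..T} \<Longrightarrow> y \<in> {-pi..pi} \<Longrightarrow> \<bar>Uty t y\<bar> \<le> \<rho> * q"
    and spectral: "t \<in> {0..T} \<Longrightarrow> c * integral {-pi..pi} (\<lambda>y. (norm (g t y))\<^sup>2)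
      \<le> integral {-pi..pi} (\<lambda>y. (Uy t y)\<^sup>2 * (norm (g t y))\<^sup>2) / q\<^sup>2
        + q\<^sup>2 * integral {-pi..pi} (\<lambda>y. (norm (gy t y))\<^sup>2)"
begin

lemma ss: "s * s = 1"
  using s by (metis abs_mult_self_eq mult_1)

text \<open>The weights obey the constraints solved in \<open>hypocoercive_constants\<close>.
  \<open>\<mu>\<close> is the speed at which they are switched on; \<open>\<mu> \<le> \<rho>\<close>
  keeps the terms from differentiating the switch at the scale of the others.\<close>

context
  fixes \<alpha> \<beta> \<gamma> \<mu> :: real
  assumes pos: "0 < \<alpha>" "0 < \<beta>" "0 < \<gamma>"
    and small: "\<alpha> \<le> 1/4" "\<beta> \<le> 1" "\<gamma> \<le> 1"
    and \<gamma>\<beta>: "12 * \<gamma> * L \<le> \<beta>" and \<beta>\<alpha>\<gamma>: "2 * \<beta>\<^sup>2 \<le> \<alpha> * \<gamma>"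
    and cross: "4 * L * (\<alpha> * L + 2 * \<beta> + 2 * \<gamma> * K)\<^sup>2 \<le> \<beta>"
    and lower: "2 * \<beta>\<^sup>2 + \<beta>\<^sup>2 * K\<^sup>2 / (2 * \<alpha>) + \<gamma> / 2 \<le> \<beta> * c / (8 * L)"
    and \<mu>: "0 \<le> \<mu>" "\<mu> \<le> \<rho>"
begin

text \<open>
  The factor \<open>\<tau> = \<mu> * t\<close> switches the derivative terms on gradually, so that the functional at
  time 0 only involves the \<open>L\<^sup>2\<close> norm.
\<close>

definition "eF t y = 1/2 * eA t y + \<alpha> * (\<mu> * t) / 2 * q\<^sup>2 * eB t y + \<beta> * (\<mu> * t)\<^sup>2 * s * eG t y
  + \<gamma> / (2 * q\<^sup>2) * (\<mu> * t) ^ 3 * eE t y"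

definition "dF t y = 1/2 * dA t y + (\<alpha> * \<mu> / 2 * q\<^sup>2 * eB t y + \<alpha> * (\<mu> * t) / 2 * q\<^sup>2 * dB t y)
  + (2 * \<beta> * \<mu> * (\<mu> * t) * s * eG t y + \<beta> * (\<mu> * t)\<^sup>2 * s * dG t y)
  + (\<gamma> / (2 * q\<^sup>2) * (3 * \<mu> * (\<mu> * t)\<^sup>2) * eE t y + \<gamma> / (2 * q\<^sup>2) * (\<mu> * t) ^ 3 * dE t y)"

text \<open>The part of the dissipation kept for the final estimate; up to the switch factor on
  \<open>eE\<close>, its integral is the right-hand side of \<open>spectral\<close>.\<close>

definition "good t y = q\<^sup>2 * eB t y + (\<mu> * t)\<^sup>2 / q\<^sup>2 * eE t y"

lemma continuous_F:
  assumes "t \<in> {0..T}"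
  shows "continuous_on S (eF t)" "continuous_on S (dF t)" "continuous_on S (good t)"
  unfolding eF_def[abs_def] dF_def[abs_def] good_def[abs_def] using q
  by (intro continuous_intros continuous_densities[OF assms]; simp)+

lemma eF_eq:
  assumes t: "t \<in> {0..T}"
  shows "integral {-pi..pi} (eF t) = 1/2 * integral {-pi..pi} (eA t)
    + \<alpha> * (\<mu> * t) / 2 * q\<^sup>2 * integral {-pi..pi} (eB t)
    + \<beta> * (\<mu> * t)\<^sup>2 * s * integral {-pi..pi} (eG t)
    + \<gamma> / (2 * q\<^sup>2) * (\<mu> * t) ^ 3 * integral {-pi..pi} (eE t)"
proof -
  have i: "eA t integrable_on {-pi..pi}" "eB t integrable_on {-pi..pi}"
    "eG t integrable_on {-pi..pi}" "eE t integrable_on {-pi..pi}"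
    by (intro integrable_continuous_real continuous_densities[OF t])+
  have "(eF t has_integral (1/2 * integral {-pi..pi} (eA t)
    + \<alpha> * (\<mu> * t) / 2 * q\<^sup>2 * integral {-pi..pi} (eB t)
    + \<beta> * (\<mu> * t)\<^sup>2 * s * integral {-pi..pi} (eG t)
    + \<gamma> / (2 * q\<^sup>2) * (\<mu> * t) ^ 3 * integral {-pi..pi} (eE t))) {-pi..pi}"
    unfolding eF_def[abs_def]
    by (intro has_integral_add has_integral_mult_right integrable_integral i)
  then show ?thesis by (rule integral_unique)
qed

lemma F_deriv:
  assumes t: "t \<in> {0..T}"
  shows "((\<lambda>t. integral {-pi..pi} (eF t)) has_real_derivative integral {-pi..pi} (dF t)) (at t within {0..T})"
proof -
  have i: "eB t integrable_on {-pi..pi}" "eG t integrable_on {-pi..pi}" "eE t integrable_on {-pi..pi}"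
    "dA t integrable_on {-pi..pi}" "dB t integrable_on {-pi..pi}"
    "dG t integrable_on {-pi..pi}" "dE t integrable_on {-pi..pi}"
    by (intro integrable_continuous_real continuous_densities[OF t])+
  let ?D = "1/2 * integral {-pi..pi} (dA t)
    + (\<alpha> * \<mu> / 2 * q\<^sup>2 * integral {-pi..pi} (eB t) + \<alpha> * (\<mu> * t) / 2 * q\<^sup>2 * integral {-pi..pi} (dB t))
    + (2 * \<beta> * \<mu> * (\<mu> * t) * s * integral {-pi..pi} (eG t) + \<beta> * (\<mu> * t)\<^sup>2 * s * integral {-pi..pi} (dG t))
    + (\<gamma> / (2 * q\<^sup>2) * (3 * \<mu> * (\<mu> * t)\<^sup>2) * integral {-pi..pi} (eE t)
      + \<gamma> / (2 * q\<^sup>2) * (\<mu> * t) ^ 3 * integral {-pi..pi} (dE t))"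
  have "(dF t has_integral ?D) {-pi..pi}"
    unfolding dF_def[abs_def]
    by (intro has_integral_add has_integral_mult_right integrable_integral i)
  then have D: "integral {-pi..pi} (dF t) = ?D" by (rule integral_unique)
  have p: "((\<lambda>t. \<alpha> * (\<mu> * t) / 2 * q\<^sup>2) has_real_derivative \<alpha> * \<mu> / 2 * q\<^sup>2) (at t within {0..T})"
    "((\<lambda>t. \<beta> * (\<mu> * t)\<^sup>2 * s) has_real_derivative 2 * \<beta> * \<mu> * (\<mu> * t) * s) (at t within {0..T})"
    "((\<lambda>t. e * (\<mu> * t) ^ 3) has_real_derivative e * (3 * \<mu> * (\<mu> * t)\<^sup>2)) (at t within {0..T})" for e
    by (auto intro!: derivative_eq_intros)
  have "((\<lambda>t. 1/2 * integral {-pi..pi} (eA t)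
    + \<alpha> * (\<mu> * t) / 2 * q\<^sup>2 * integral {-pi..pi} (eB t)
    + \<beta> * (\<mu> * t)\<^sup>2 * s * integral {-pi..pi} (eG t)
    + \<gamma> / (2 * q\<^sup>2) * (\<mu> * t) ^ 3 * integral {-pi..pi} (eE t)) has_real_derivative ?D) (at t within {0..T})"
    by (rule DERIV_cong[OF DERIV_add[OF DERIV_add[OF DERIV_add[OF DERIV_cmult[OF A_deriv[OF t]]
          DERIV_mult[OF p(1) B_deriv[OF t]]] DERIV_mult[OF p(2) G_deriv[OF t]]]
          DERIV_mult[OF p(3) E_deriv[OF t]]]])
       (simp add: mult.commute)
  then show ?thesis
    unfolding D
    by (rule has_field_derivative_transform_within[OF _ zero_less_one t]) (simp add: eF_eq)
qed

text \<open>The powers 1, 2, 3 of the switch form a geometric progression, so the discriminant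
  condition on \<open>\<beta>\<^sup>2\<close> and \<open>\<alpha> * \<gamma>\<close> controls the
  mixed term uniformly in time. In the second bound the factor \<open>(\<mu> * t)\<^sup>2\<close> is
  the one that \<open>eE\<close> carries in \<open>good\<close>.\<close>

lemma eF_bounds:
  assumes t: "t \<in> {0..T}" and \<tau>: "0 \<le> \<mu> * t" "\<mu> * t \<le> 1"
  shows "1/2 * eA t y \<le> eF t y" "(\<mu> * t)\<^sup>2 * eF t y \<le> 1/2 * (\<mu> * t)\<^sup>2 * eA t y + good t y"
proof -
  define a b w \<tau> where "a = norm (g t y)" "b = q * norm (gy t y)" "w = \<bar>Uy t y\<bar> / q" "\<tau> = \<mu> * t"
  note d = this
  have nn: "0 \<le> a" "0 \<le> b" "0 \<le> w" "0 \<le> \<tau>" "\<tau> \<le> 1" using \<tau> q by (auto simp: d)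
  have A: "eA t y = a\<^sup>2" by (simp add: eA_def d)
  have B: "q\<^sup>2 * eB t y = b\<^sup>2" by (simp add: eB_def d power_mult_distrib)
  have E: "eE t y / q\<^sup>2 = w\<^sup>2 * a\<^sup>2" by (simp add: eE_def d power_divide)
  have wab: "\<bar>Uy t y\<bar> * norm (\<i> * g t y) * norm (gy t y) = w * a * b"
    using q by (simp add: d norm_mult)
  have "s * eG t y \<le> w * a * b" "- (s * eG t y) \<le> w * a * b"
    using weighted_inner_le[of "s * Uy t y" "\<bar>Uy t y\<bar>" "\<i> * g t y" "gy t y"]
      weighted_inner_le[of "- (s * Uy t y)" "\<bar>Uy t y\<bar>" "\<i> * g t y" "gy t y"] s
    unfolding wab by (simp_all add: eG_def abs_mult mult.assoc)
  then have G: "\<bar>s * eG t y\<bar> \<le> w * a * b" by (simp only: abs_le_iff)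
  have eF: "eF t y = 1/2 * a\<^sup>2 + \<alpha> / 2 * \<tau> * b\<^sup>2 + \<beta> * \<tau>\<^sup>2 * (s * eG t y) + \<gamma> / 2 * \<tau> ^ 3 * (w\<^sup>2 * a\<^sup>2)"
    unfolding eF_def by (simp add: A d(4) flip: B E)
  have Gu: "\<beta> * \<tau>\<^sup>2 * (s * eG t y) \<le> \<beta> * \<tau>\<^sup>2 * (w * a * b)"
    and Gl: "- (\<beta> * \<tau>\<^sup>2 * (w * a * b)) \<le> \<beta> * \<tau>\<^sup>2 * (s * eG t y)"
    using G pos mult_left_mono[of "s * eG t y" "w * a * b" "\<beta> * \<tau>\<^sup>2"]
      mult_left_mono[of "- (w * a * b)" "s * eG t y" "\<beta> * \<tau>\<^sup>2"] by auto
  have "\<beta> * \<tau> * w * a * b \<le> \<alpha> / 2 * b\<^sup>2 + \<gamma> / 2 * (\<tau> * w * a)\<^sup>2"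
  proof -
    have "(\<beta> * b * (\<tau> * w * a)) \<le> \<alpha> / 2 * b\<^sup>2 + \<beta>\<^sup>2 / (2 * \<alpha>) * (\<tau> * w * a)\<^sup>2"
    proof -
      have "0 \<le> (\<alpha> * b - \<beta> * (\<tau> * w * a))\<^sup>2 / (2 * \<alpha>)" using pos by simp
      also have "\<dots> = \<alpha> / 2 * b\<^sup>2 + \<beta>\<^sup>2 / (2 * \<alpha>) * (\<tau> * w * a)\<^sup>2 - (\<beta> * b * (\<tau> * w * a))"
        using pos by (simp add: field_simps power2_eq_square)
      finally show ?thesis by simp
    qed
    also have "\<beta>\<^sup>2 / (2 * \<alpha>) * (\<tau> * w * a)\<^sup>2 \<le> \<gamma> / 2 * (\<tau> * w * a)\<^sup>2"
    proof (rule mult_right_mono)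
      have "\<beta>\<^sup>2 \<le> \<alpha> * \<gamma>" using \<beta>\<alpha>\<gamma> zero_le_power2[of \<beta>] by linarith
      then show "\<beta>\<^sup>2 / (2 * \<alpha>) \<le> \<gamma> / 2" using pos by (simp add: field_simps)
    qed simp
    finally show ?thesis by (simp add: mult_ac)
  qed
  from mult_left_mono[OF this nn(4)]
  have "\<beta> * \<tau>\<^sup>2 * (w * a * b) \<le> \<alpha> / 2 * \<tau> * b\<^sup>2 + \<gamma> / 2 * \<tau> ^ 3 * (w\<^sup>2 * a\<^sup>2)"
    by (simp add: algebra_simps power2_eq_square power3_eq_cube)
  then show "1/2 * eA t y \<le> eF t y" using Gl unfolding eF A by linarith
  have gd: "good t y = b\<^sup>2 + \<tau>\<^sup>2 * (w\<^sup>2 * a\<^sup>2)" by (simp add: good_def d(4) flip: B E)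
  have "eF t y \<le> 1/2 * a\<^sup>2 + b\<^sup>2 + w\<^sup>2 * a\<^sup>2"
  proof -
    have "\<alpha> / 2 * \<tau> * b\<^sup>2 \<le> 1/2 * 1 * b\<^sup>2"
      using pos small nn by (intro mult_mono) auto
    moreover have "\<beta> * \<tau>\<^sup>2 * (w * a * b) \<le> 1 * (w * a * b)"
      using pos small nn by (intro mult_mono mult_le_one) (auto simp: power_le_one)
    moreover have "w * a * b \<le> 1/2 * b\<^sup>2 + 1/2 * (w\<^sup>2 * a\<^sup>2)"
      using sum_squares_bound[of "w * a" b] by (simp add: power_mult_distrib field_simps)
    moreover have "\<gamma> / 2 * \<tau> ^ 3 * (w\<^sup>2 * a\<^sup>2) \<le> 1/2 * 1 * (w\<^sup>2 * a\<^sup>2)"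
      using pos small nn by (intro mult_mono) (auto simp: power_le_one)
    ultimately show ?thesis using Gu unfolding eF by linarith
  qed
  then have "\<tau>\<^sup>2 * eF t y \<le> \<tau>\<^sup>2 * (1/2 * a\<^sup>2 + b\<^sup>2 + w\<^sup>2 * a\<^sup>2)" by (rule mult_left_mono) simp
  also have "\<dots> = 1/2 * \<tau>\<^sup>2 * a\<^sup>2 + \<tau>\<^sup>2 * b\<^sup>2 + \<tau>\<^sup>2 * (w\<^sup>2 * a\<^sup>2)" by (simp add: algebra_simps)
  also have "\<tau>\<^sup>2 * b\<^sup>2 \<le> 1 * b\<^sup>2" using nn by (intro mult_right_mono) (auto simp: power_le_one)
  finally show "(\<mu> * t)\<^sup>2 * eF t y \<le> 1/2 * (\<mu> * t)\<^sup>2 * eA t y + good t y"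
    unfolding A gd by (simp add: d(4))
qed

text \<open>In the rescaled amplitudes each term estimated carries exactly one factor
  \<open>\<rho>\<close>, and what remains is the quadratic form of
  \<open>hypocoercive_quadratic_bound\<close>.\<close>

lemma dF_le:
  assumes t: "t \<in> {0..T}" and \<tau>: "0 \<le> \<mu> * t" "\<mu> * t \<le> 1" and y: "y \<in> {-pi..pi}"
  shows "dF t y \<le> - (\<rho> * \<beta> / (2 * L)) * good t y + \<rho> * (\<beta> * c / (8 * L)) * ((\<mu> * t)\<^sup>2 * eA t y)"
proof -
  define a b d w \<tau> where "a = norm (g t y)" "b = q * norm (gy t y)" "d = q\<^sup>2 * norm (gyy t y)"
    "w = \<bar>Uy t y\<bar> / q" "\<tau> = \<mu> * t"
  note ds = this
  have nn: "0 \<le> a" "0 \<le> b" "0 \<le> d" "0 \<le> w" "0 \<le> \<tau>" "\<tau> \<le> 1" using \<tau> q by (auto simp: ds)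
  have n: "norm (g t y) = a" "norm (\<i> * g t y) = a" "norm (gy t y) = b / q" "norm (gyy t y) = d / q\<^sup>2"
    "norm (\<i> * gyy t y) = d / q\<^sup>2" "\<bar>Uy t y\<bar> = q * w"
    using q by (auto simp: ds norm_mult)
  have U2: "(Uy t y)\<^sup>2 = q\<^sup>2 * w\<^sup>2" by (metis n(6) power2_abs power_mult_distrib)
  have \<nu>: "\<nu> / q\<^sup>2 = \<rho>" "0 < \<nu>" using q \<rho> by (auto simp: \<nu>_eq)
  \<comment> \<open>The contributions of \<open>\<sigma>\<close> add up to a nonpositive multiple of
    \<open>eF\<close>, so nonnegativity of \<open>eF\<close> disposes of all of them, including the
    mixed one.\<close>
  have Fnn: "0 \<le> \<sigma> * \<nu> * k\<^sup>2 * (2 * eF t y)"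
  proof -
    have "0 \<le> eF t y" using eF_bounds(1)[OF t \<tau>, of y] zero_le_power2[of "norm (g t y)"]
      unfolding eA_def by linarith
    then show ?thesis using \<sigma> \<nu> by simp
  qed
  let ?i1 = "inner (\<i> * g t y) (gy t y)" and ?i2 = "inner (\<i> * gyy t y) (gy t y)"
    and ?i3 = "inner (\<i> * g t y) (gyy t y)" and ?i4 = "inner (g t y) (gy t y)"
  have split: "dF t y = - \<rho> * b\<^sup>2 + \<alpha> * \<mu> / 2 * b\<^sup>2 - \<rho> * \<alpha> * \<tau> * d\<^sup>2
    + \<alpha> * \<tau> * (- (q\<^sup>2 * k * Vy t y) * ?i1)
    + 2 * \<beta> * \<tau> * (\<mu> * s * Uy t y * ?i1)
    + \<beta> * \<tau>\<^sup>2 * (s * Uty t y * ?i1) + 2 * \<beta> * \<tau>\<^sup>2 * (\<nu> * s * Uy t y * ?i2)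
    + \<beta> * \<tau>\<^sup>2 * (- (\<nu> * s * Uyy t y) * ?i3)
    + \<beta> * \<tau>\<^sup>2 * a\<^sup>2 * (- (s * k * (Uy t y * Vy t y)))
    + 3 / 2 * \<gamma> * \<tau>\<^sup>2 * (\<mu> * w\<^sup>2 * a\<^sup>2) + \<gamma> * \<tau> ^ 3 * a\<^sup>2 * (Uy t y * Uty t y / q\<^sup>2)
    - \<rho> * \<gamma> * \<tau> ^ 3 * w\<^sup>2 * b\<^sup>2
    + 2 * \<gamma> * \<tau> ^ 3 * (- (\<rho> * Uy t y * Uyy t y) * ?i4)
    - \<sigma> * \<nu> * k\<^sup>2 * (2 * eF t y)"
    using q unfolding dF_def eF_def d_defs e_defs n U2 ds(5)[symmetric]
    by (simp add: \<nu>_eq field_simps)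
  have kabs: "\<bar>k\<bar> * q\<^sup>2 = \<rho>" using q \<rho> s by (simp add: k_eq abs_mult)
  have e0: "\<alpha> * \<mu> / 2 * b\<^sup>2 \<le> \<rho> * (\<alpha> / 2 * b\<^sup>2)"
    using mult_right_mono[OF \<mu>(2), of "\<alpha> / 2 * b\<^sup>2"] pos by (simp add: mult_ac)
  have e1: "- (q\<^sup>2 * k * Vy t y) * ?i1 \<le> \<rho> * (L * w * a * b)"
  proof -
    have "\<bar>- (q\<^sup>2 * k * Vy t y)\<bar> = \<rho> * \<bar>Vy t y\<bar>" using kabs by (simp add: abs_mult mult_ac)
    also have "\<dots> \<le> \<rho> * (L * (q * w))" using Vy_le[OF t, of y] \<rho> by (intro mult_left_mono) (auto simp: n)
    finally show ?thesis using weighted_inner_le[of _ _ "\<i> * g t y" "gy t y"] q by (fastforce simp: n)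
  qed
  have e2: "\<mu> * s * Uy t y * ?i1 \<le> \<rho> * (w * a * b)"
  proof -
    have "\<bar>\<mu> * s * Uy t y\<bar> \<le> \<rho> * (q * w)" using \<mu> s q nn by (simp add: abs_mult n mult_right_mono)
    then show ?thesis using weighted_inner_le[of _ _ "\<i> * g t y" "gy t y"] q by (fastforce simp: n)
  qed
  \<comment> \<open>The bound on \<open>Uty\<close> acts at its natural scale:
    \<open>\<rho> * q\<close> times \<open>norm (gy t y) = b / q\<close> is
    \<open>\<rho> * b\<close>. The same bound gives \<open>e8\<close>.\<close>
  have e3: "s * Uty t y * ?i1 \<le> \<rho> * (a * b)"
  proof -
    have "\<bar>s * Uty t y\<bar> \<le> \<rho> * q" using Uty_le[OF t y] s by (simp add: abs_mult)
    then show ?thesis using weighted_inner_le[of _ _ "\<i> * g t y" "gy t y"] q by (fastforce simp: n)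
  qed
  have e4: "\<nu> * s * Uy t y * ?i2 \<le> \<rho> * (w * b * d)"
  proof -
    have "\<bar>\<nu> * s * Uy t y\<bar> \<le> \<rho> * q\<^sup>2 * (q * w)" using \<rho> s by (simp add: abs_mult n \<nu>_eq)
    from weighted_inner_le[OF this, of "\<i> * gyy t y" "gy t y"] show ?thesis
      using q by (simp add: n mult_ac)
  qed
  have e5: "- (\<nu> * s * Uyy t y) * ?i3 \<le> \<rho> * (K * a * d)"
  proof -
    have "\<bar>- (\<nu> * s * Uyy t y)\<bar> \<le> \<rho> * q\<^sup>2 * K"
      using \<nu> s Uyy_le[OF t y] by (simp add: abs_mult mult_left_mono flip: \<nu>_eq)
    from weighted_inner_le[OF this, of "\<i> * g t y" "gyy t y"] show ?thesis
      using q by (simp add: n mult_ac)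
  qed
  \<comment> \<open>\<open>s * k\<close> is the absolute value of \<open>k\<close>, so the mixed
    term damps for either sign of the frequency; \<open>phase\<close> bounds \<open>Uy * Vy\<close>
    from below by \<open>Uy\<^sup>2 / L\<close>.\<close>
  have e6: "- (s * k * (Uy t y * Vy t y)) \<le> - (\<rho> * (w\<^sup>2 / L))"
  proof -
    have "s * k * q\<^sup>2 = \<rho>" using q ss by (simp add: k_eq mult.assoc[symmetric])
    then have sk: "s * k = \<rho> / q\<^sup>2" using q by (simp add: field_simps)
    have "q\<^sup>2 * w\<^sup>2 / L \<le> Uy t y * Vy t y" using phase[OF t, of y] L by (simp add: U2 field_simps)
    then have "\<rho> / q\<^sup>2 * (q\<^sup>2 * w\<^sup>2 / L) \<le> \<rho> / q\<^sup>2 * (Uy t y * Vy t y)"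
      using \<rho> by (intro mult_left_mono) auto
    moreover have "\<rho> / q\<^sup>2 * (q\<^sup>2 * w\<^sup>2 / L) = \<rho> * (w\<^sup>2 / L)" using q by simp
    ultimately show ?thesis unfolding sk by linarith
  qed
  have e7: "\<mu> * w\<^sup>2 * a\<^sup>2 \<le> \<rho> * (w\<^sup>2 * a\<^sup>2)"
    using mult_right_mono[OF \<mu>(2), of "w\<^sup>2 * a\<^sup>2"] by (simp add: mult_ac)
  have e8: "Uy t y * Uty t y / q\<^sup>2 \<le> \<rho> * w"
  proof -
    have "\<bar>Uy t y * Uty t y\<bar> \<le> (q * w) * (\<rho> * q)"
      unfolding abs_mult n using q nn by (intro mult_left_mono Uty_le t y) auto
    then have "Uy t y * Uty t y \<le> (\<rho> * w) * q\<^sup>2" by (simp add: power2_eq_square mult_ac)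
    then show ?thesis using q by (simp add: pos_divide_le_eq)
  qed
  have e9: "- (\<rho> * Uy t y * Uyy t y) * ?i4 \<le> \<rho> * (K * w * a * b)"
  proof -
    have "\<bar>- (\<rho> * Uy t y * Uyy t y)\<bar> \<le> \<rho> * (q * w) * K"
      using \<rho> q nn Uyy_le[OF t y] by (simp add: abs_mult n mult_left_mono)
    from weighted_inner_le[OF this, of "g t y" "gy t y"] show ?thesis
      using q by (simp add: n mult_ac)
  qed
  have P: "0 \<le> \<alpha> * \<tau>" "0 \<le> 2 * \<beta> * \<tau>" "0 \<le> \<beta> * \<tau>\<^sup>2" "0 \<le> 2 * \<beta> * \<tau>\<^sup>2" "0 \<le> 3 / 2 * \<gamma> * \<tau>\<^sup>2"
    "0 \<le> \<gamma> * \<tau> ^ 3 * a\<^sup>2" "0 \<le> 2 * \<gamma> * \<tau> ^ 3" "0 \<le> \<beta> * \<tau>\<^sup>2 * a\<^sup>2"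
    using pos nn by auto
  let ?Q = "- b\<^sup>2 + \<alpha> / 2 * b\<^sup>2 - \<alpha> * \<tau> * d\<^sup>2 + \<alpha> * \<tau> * L * w * a * b + 2 * \<beta> * \<tau> * w * a * b
      - \<beta> / L * \<tau>\<^sup>2 * w\<^sup>2 * a\<^sup>2 + \<beta> * \<tau>\<^sup>2 * a * b + 2 * \<beta> * \<tau>\<^sup>2 * w * b * d + \<beta> * \<tau>\<^sup>2 * K * a * d
      + 3 / 2 * \<gamma> * \<tau>\<^sup>2 * w\<^sup>2 * a\<^sup>2 + \<gamma> * \<tau> ^ 3 * w * a\<^sup>2 + 2 * \<gamma> * \<tau> ^ 3 * K * w * a * b
      - \<gamma> * \<tau> ^ 3 * w\<^sup>2 * b\<^sup>2"
  have "dF t y \<le> \<rho> * ?Q"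
  proof -
    have "dF t y \<le> - \<rho> * b\<^sup>2 + \<rho> * (\<alpha> / 2 * b\<^sup>2) - \<rho> * \<alpha> * \<tau> * d\<^sup>2 + \<alpha> * \<tau> * (\<rho> * (L * w * a * b))
      + 2 * \<beta> * \<tau> * (\<rho> * (w * a * b)) + \<beta> * \<tau>\<^sup>2 * (\<rho> * (a * b)) + 2 * \<beta> * \<tau>\<^sup>2 * (\<rho> * (w * b * d))
      + \<beta> * \<tau>\<^sup>2 * (\<rho> * (K * a * d)) + \<beta> * \<tau>\<^sup>2 * a\<^sup>2 * (- (\<rho> * (w\<^sup>2 / L)))
      + 3 / 2 * \<gamma> * \<tau>\<^sup>2 * (\<rho> * (w\<^sup>2 * a\<^sup>2)) + \<gamma> * \<tau> ^ 3 * a\<^sup>2 * (\<rho> * w)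
      - \<rho> * \<gamma> * \<tau> ^ 3 * w\<^sup>2 * b\<^sup>2 + 2 * \<gamma> * \<tau> ^ 3 * (\<rho> * (K * w * a * b))"
      using mult_left_mono[OF e1 P(1)] mult_left_mono[OF e2 P(2)] mult_left_mono[OF e3 P(3)]
        mult_left_mono[OF e4 P(4)] mult_left_mono[OF e5 P(3)] mult_left_mono[OF e6 P(8)]
        mult_left_mono[OF e7 P(5)] mult_left_mono[OF e8 P(6)] mult_left_mono[OF e9 P(7)] e0 Fnn
      unfolding split by linarith
    also have "\<dots> = \<rho> * ?Q" by (simp add: algebra_simps)
    finally show ?thesis .
  qed
  also have "\<dots> \<le> \<rho> * (- (1/2) * b\<^sup>2 - \<beta> / (2 * L) * (\<tau> * w * a)\<^sup>2
      + (2 * \<beta>\<^sup>2 + \<beta>\<^sup>2 * K\<^sup>2 / (2 * \<alpha>) + \<gamma> / 2) * (\<tau>\<^sup>2 * a\<^sup>2))"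
    using hypocoercive_quadratic_bound[OF nn pos _ K small(1) \<gamma>\<beta> \<beta>\<alpha>\<gamma> cross] \<rho> L
    by (intro mult_left_mono) auto
  \<comment> \<open>The coefficient of \<open>b\<^sup>2\<close> is weakened to that of the weighted
    mass, so that the two combine to \<open>good\<close>; \<open>lower\<close> caps the
    leftover.\<close>
  also have "\<dots> \<le> \<rho> * (- (\<beta> / (2 * L)) * b\<^sup>2 - \<beta> / (2 * L) * (\<tau> * w * a)\<^sup>2 + \<beta> * c / (8 * L) * (\<tau>\<^sup>2 * a\<^sup>2))"
  proof -
    have "\<beta> / (2 * L) * b\<^sup>2 \<le> 1/2 * b\<^sup>2"
      using small pos L by (intro mult_right_mono) (auto simp: field_simps)
    moreover have "(2 * \<beta>\<^sup>2 + \<beta>\<^sup>2 * K\<^sup>2 / (2 * \<alpha>) + \<gamma> / 2) * (\<tau>\<^sup>2 * a\<^sup>2) \<le> \<beta> * c / (8 * L) * (\<tau>\<^sup>2 * a\<^sup>2)"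
      by (rule mult_right_mono[OF lower]) simp
    ultimately show ?thesis using \<rho> by (intro mult_left_mono) auto
  qed
  also have "\<dots> = - (\<rho> * \<beta> / (2 * L)) * good t y + \<rho> * (\<beta> * c / (8 * L)) * ((\<mu> * t)\<^sup>2 * eA t y)"
    using q unfolding good_def e_defs n U2 ds(5)[symmetric]
    by (simp add: algebra_simps power_mult_distrib power_divide)
  finally show ?thesis .
qed

text \<open>With \<open>\<rho> * C\<close> as unit, \<open>dF_le\<close> supplies four units of
  \<open>good\<close>. By \<open>spectral\<close>, one unit pays for the leftover mass and at most
  one and a half for the functional.\<close>

lemma dF_integral_le:
  assumes t: "t \<in> {0..T}" and \<tau>: "0 \<le> \<mu> * t" "\<mu> * t \<le> 1"
  shows "integral {-pi..pi} (dF t) \<le> - (\<beta> * c / (8 * L)) * \<rho> * (\<mu> * t)\<^sup>2 * integral {-pi..pi} (eF t)"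
proof -
  define \<tau> where "\<tau> = \<mu> * t"
  define C where "C = \<beta> / (8 * L)"
  have C: "0 < C" using pos L by (simp add: C_def)
  have \<tau>2: "0 \<le> \<tau>\<^sup>2" "\<tau>\<^sup>2 \<le> 1" using assms by (auto simp: \<tau>_def power_le_one)
  let ?A = "integral {-pi..pi} (eA t)" and ?G = "integral {-pi..pi} (good t)"
    and ?F = "integral {-pi..pi} (eF t)"
  have i: "eA t integrable_on {-pi..pi}" "good t integrable_on {-pi..pi}"
    "eB t integrable_on {-pi..pi}" "eE t integrable_on {-pi..pi}"
    "eF t integrable_on {-pi..pi}" "dF t integrable_on {-pi..pi}"
    by (intro integrable_continuous_real continuous_densities[OF t] continuous_F[OF t])+
  have 1: "integral {-pi..pi} (dF t) \<le> - (4 * \<rho> * C) * ?G + \<rho> * (C * c) * (\<tau>\<^sup>2 * ?A)"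
  proof (rule has_integral_le[OF integrable_integral[OF i(6)]])
    show "((\<lambda>y. - (4 * \<rho> * C) * good t y + \<rho> * (C * c) * (\<tau>\<^sup>2 * eA t y)) has_integral
        - (4 * \<rho> * C) * ?G + \<rho> * (C * c) * (\<tau>\<^sup>2 * ?A)) {-pi..pi}"
      by (intro has_integral_add has_integral_mult_right integrable_integral i)
    have "4 * \<rho> * C = \<rho> * \<beta> / (2 * L)" "\<rho> * (C * c) = \<rho> * (\<beta> * c / (8 * L))" by (auto simp: C_def)
    then show "dF t y \<le> - (4 * \<rho> * C) * good t y + \<rho> * (C * c) * (\<tau>\<^sup>2 * eA t y)"
      if "y \<in> {-pi..pi}" for y
      using dF_le[OF t assms(2,3) that] by (simp only: \<tau>_def)
  qed
  have 2: "\<tau>\<^sup>2 * ?F \<le> 1/2 * \<tau>\<^sup>2 * ?A + ?G"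
    by (rule has_integral_le[OF has_integral_mult_right has_integral_add[OF has_integral_mult_right]])
       (use i eF_bounds(2)[OF t assms(2,3)] in \<open>auto simp: \<tau>_def intro!: integrable_integral\<close>)
  have 3: "?G = q\<^sup>2 * integral {-pi..pi} (eB t) + \<tau>\<^sup>2 / q\<^sup>2 * integral {-pi..pi} (eE t)"
    unfolding good_def[abs_def] \<tau>_def[symmetric]
    by (intro integral_unique has_integral_add has_integral_mult_right integrable_integral i)
  have B0: "0 \<le> integral {-pi..pi} (eB t)" "0 \<le> ?A" "0 \<le> integral {-pi..pi} (eE t)"
    by (auto intro!: integral_nonneg i simp: e_defs)
  then have G0: "0 \<le> ?G" unfolding 3 by simp
  \<comment> \<open>Multiplying \<open>spectral\<close> by \<open>\<tau>\<^sup>2\<close> puts the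
    factor on \<open>eE\<close>, where \<open>good\<close> has it; on \<open>eB\<close> it is
    dropped, being at most 1.\<close>
  have 4: "c * (\<tau>\<^sup>2 * ?A) \<le> ?G"
  proof -
    have "\<tau>\<^sup>2 * (c * ?A) \<le> \<tau>\<^sup>2 * (integral {-pi..pi} (eE t) / q\<^sup>2 + q\<^sup>2 * integral {-pi..pi} (eB t))"
      using spectral[OF t] by (intro mult_left_mono) (auto simp: e_defs[abs_def])
    also have "\<dots> = \<tau>\<^sup>2 / q\<^sup>2 * integral {-pi..pi} (eE t) + \<tau>\<^sup>2 * (q\<^sup>2 * integral {-pi..pi} (eB t))"
      by (simp add: algebra_simps)
    also have "\<tau>\<^sup>2 * (q\<^sup>2 * integral {-pi..pi} (eB t)) \<le> 1 * (q\<^sup>2 * integral {-pi..pi} (eB t))"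
      using B0 \<tau>2 by (intro mult_right_mono) auto
    finally show ?thesis unfolding 3 by (simp add: mult_ac)
  qed
  have "c * (\<tau>\<^sup>2 * ?F) \<le> c * (1/2 * \<tau>\<^sup>2 * ?A + ?G)"
    using mult_left_mono[OF 2, of c] c by simp
  also have "\<dots> \<le> 4 * ?G - c * (\<tau>\<^sup>2 * ?A)"
  proof -
    have "c * ?G \<le> 1 * ?G" using c G0 by (intro mult_right_mono) auto
    then show ?thesis using 4 G0 by (simp add: algebra_simps)
  qed
  finally have "\<rho> * C * (c * (\<tau>\<^sup>2 * ?F)) \<le> \<rho> * C * (4 * ?G - c * (\<tau>\<^sup>2 * ?A))"
    using \<rho> C by (intro mult_left_mono) auto
  then show ?thesis using 1 by (simp add: C_def \<tau>_def algebra_simps)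
qed

end

end

section \<open>From the differential inequality to exponential decay\<close>

lemma has_nonpos_derivative_imp_le:
  fixes f :: "real \<Rightarrow> real"
  assumes "\<And>u. u \<in> {a..b} \<Longrightarrow> (f has_real_derivative f' u) (at u within {a..b})"
    and "\<And>u. u \<in> {a..b} \<Longrightarrow> f' u \<le> 0" and "a \<le> b"
  shows "f b \<le> f a"
proof (cases "a = b")
  case False
  with assms(3) have "a < b" by simp
  from mvt_simple[OF this, of f "\<lambda>u. (*) (f' u)"] assms(1)
  obtain x where "x \<in> {a<..<b}" "f b - f a = f' x * (b - a)"
    by (auto simp: has_field_derivative_def)
  moreover from this have "f' x * (b - a) \<le> 0"
    using assms(2)[of x] by (intro mult_nonpos_nonneg) auto
  ultimately show ?thesis by simp
qed simp

context shear_mode begin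

lemma mass_antimono:
  assumes t: "t \<in> {0..T}" and "0 \<le> \<nu>" "0 \<le> \<sigma>"
  shows "integral {-pi..pi} (eA t) \<le> integral {-pi..pi} (eA 0)"
proof (rule has_nonpos_derivative_imp_le[where a = 0 and b = t
      and f = "\<lambda>u. integral {-pi..pi} (eA u)" and f' = "\<lambda>u. integral {-pi..pi} (dA u)"])
  fix u assume "u \<in> {0..t}"
  then have u: "u \<in> {0..T}" using t by auto
  show "((\<lambda>t. integral {-pi..pi} (eA t)) has_real_derivative integral {-pi..pi} (dA u)) (at u within {0..t})"
    by (rule DERIV_subset[OF A_deriv[OF u]]) (use t in auto)
  have "dA u y \<le> 0" for y
  proof -
    have "0 \<le> 2 * \<nu> * (norm (gy u y))\<^sup>2" "0 \<le> 2 * \<sigma> * \<nu> * k\<^sup>2 * eA u y"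
      unfolding eA_def using assms by (intro mult_nonneg_nonneg; simp)+
    moreover have "dA u y = - (2 * \<nu> * (norm (gy u y))\<^sup>2) - 2 * \<sigma> * \<nu> * k\<^sup>2 * eA u y"
      by (simp add: dA_def)
    ultimately show ?thesis by linarith
  qed
  then have "integral {-pi..pi} (dA u) \<le> integral {-pi..pi} (\<lambda>_. 0)"
    by (intro integral_le integrable_continuous_real continuous_densities u continuous_on_const)
  then show "integral {-pi..pi} (dA u) \<le> 0" by simp
qed (use t in auto)

lemma L2_norm_eq: "L2_norm_torus (g t) = sqrt (integral {-pi..pi} (eA t))"
  by (simp add: L2_norm_torus_def eA_def[abs_def])

text \<open>Serves the zero mode and times with \<open>\<rho> * t < 1\<close>.\<close>

lemma L2_norm_antimono:
  assumes "t \<in> {0..T}" "0 \<le> \<nu>" "0 \<le> \<sigma>"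
  shows "L2_norm_torus (g t) \<le> L2_norm_torus (g 0)"
  using mass_antimono[OF assms] by (simp add: L2_norm_eq)

end

context enhanced_shear_mode begin

text \<open>With \<open>\<mu> = 1 / t\<close> the switch runs from 0 to 1 on \<open>{0..t}\<close>,
  and \<open>1 \<le> \<rho> * t\<close> says \<open>\<mu> \<le> \<rho>\<close>. The mean of the
  squared switch is 1/3, which turns the rate \<open>\<beta> * c / (8 * L)\<close> into
  \<open>\<beta> * c / (24 * L)\<close>.\<close>

lemma mass_decay:
  assumes const: "0 < \<alpha>" "0 < \<beta>" "0 < \<gamma>" "\<alpha> \<le> 1/4" "\<beta> \<le> 1" "\<gamma> \<le> 1"
    "12 * \<gamma> * L \<le> \<beta>" "2 * \<beta>\<^sup>2 \<le> \<alpha> * \<gamma>" "4 * L * (\<alpha> * L + 2 * \<beta> + 2 * \<gamma> * K)\<^sup>2 \<le> \<beta>"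
    "2 * \<beta>\<^sup>2 + \<beta>\<^sup>2 * K\<^sup>2 / (2 * \<alpha>) + \<gamma> / 2 \<le> \<beta> * c / (8 * L)"
    and t: "t \<in> {0..T}" "1 \<le> \<rho> * t"
  shows "integral {-pi..pi} (eA t) \<le> exp (- (\<beta> * c / (24 * L)) * \<rho> * t) * integral {-pi..pi} (eA 0)"
proof -
  define \<mu> where "\<mu> = 1 / t"
  define C where "C = \<beta> * c / (8 * L)"
  have t0: "0 < t" using t \<rho> by (cases "t = 0") auto
  have \<mu>: "0 \<le> \<mu>" "\<mu> \<le> \<rho>" "\<mu> * t = 1" using t t0 by (auto simp: \<mu>_def field_simps)
  note params = const \<mu>(1,2)
  let ?F = "\<lambda>u. integral {-pi..pi} (eF \<alpha> \<beta> \<gamma> \<mu> u)"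
  \<comment> \<open>Integrating factor: the exponent is an antiderivative of
    \<open>C * \<rho> * (\<mu> * u)\<^sup>2\<close>.\<close>
  let ?Y = "\<lambda>u. ?F u * exp (C * \<rho> * \<mu>\<^sup>2 * u ^ 3 / 3)"
  have "?Y t \<le> ?Y 0"
  proof (rule has_nonpos_derivative_imp_le[where a = 0 and b = t and f = ?Y and f' = "\<lambda>u.
      (integral {-pi..pi} (dF \<alpha> \<beta> \<gamma> \<mu> u) + C * \<rho> * (\<mu> * u)\<^sup>2 * ?F u) * exp (C * \<rho> * \<mu>\<^sup>2 * u ^ 3 / 3)"])
    fix u assume u': "u \<in> {0..t}"
    then have u: "u \<in> {0..T}" and \<tau>: "0 \<le> \<mu> * u" "\<mu> * u \<le> 1"
      using t \<mu> mult_left_mono[of u t \<mu>] by auto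
    let ?e = "exp (C * \<rho> * \<mu>\<^sup>2 * u ^ 3 / 3)"
    let ?D = "integral {-pi..pi} (dF \<alpha> \<beta> \<gamma> \<mu> u)"
    have F': "(?F has_real_derivative ?D) (at u within {0..t})"
      by (rule DERIV_subset[OF F_deriv[OF params u]]) (use t in auto)
    show "(?Y has_real_derivative (?D + C * \<rho> * (\<mu> * u)\<^sup>2 * ?F u) * ?e) (at u within {0..t})"
      by (rule derivative_eq_intros F' refl | simp)+
         (simp add: algebra_simps power2_eq_square)
    have "?D + C * \<rho> * (\<mu> * u)\<^sup>2 * ?F u \<le> 0"
      using dF_integral_le[OF params u \<tau>] by (simp add: C_def)
    then show "(?D + C * \<rho> * (\<mu> * u)\<^sup>2 * ?F u) * ?e \<le> 0" by (rule mult_nonpos_nonneg) simp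
  qed (use t0 in auto)
  moreover have "?Y 0 = 1/2 * integral {-pi..pi} (eA 0)"
    using eF_eq[OF params, of 0] t by simp
  moreover have "1/2 * integral {-pi..pi} (eA t) \<le> ?F t"
  proof -
    have "integral {-pi..pi} (\<lambda>y. 1/2 * eA t y) \<le> ?F t"
      using eF_bounds(1)[OF params t(1)] \<mu>
      by (intro integral_le integrable_continuous_real continuous_intros continuous_densities
          continuous_F[OF params] t) auto
    then show ?thesis by simp
  qed
  ultimately have "1/2 * integral {-pi..pi} (eA t) * exp (C * \<rho> * \<mu>\<^sup>2 * t ^ 3 / 3)
      \<le> 1/2 * integral {-pi..pi} (eA 0)"
    by (smt (verit) exp_gt_zero mult_right_mono)
  moreover have "C * \<rho> * \<mu>\<^sup>2 * t ^ 3 / 3 = \<beta> * c / (24 * L) * \<rho> * t"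
    using t0 by (simp add: C_def \<mu>_def power2_eq_square power3_eq_cube)
  ultimately have "integral {-pi..pi} (eA t) * exp (\<beta> * c / (24 * L) * \<rho> * t) \<le> integral {-pi..pi} (eA 0)"
    by simp
  then show ?thesis by (simp add: exp_minus field_simps)
qed

text \<open>Taking the square root halves the rate. For \<open>\<rho> * t < 1\<close> the
  exponential loss is at most a factor e because \<open>\<delta> \<le> 1\<close>, and monotonicity
  of the norm suffices.\<close>

lemma L2_norm_decay:
  assumes const: "0 < \<alpha>" "0 < \<beta>" "0 < \<gamma>" "\<alpha> \<le> 1/4" "\<beta> \<le> 1" "\<gamma> \<le> 1"
    "12 * \<gamma> * L \<le> \<beta>" "2 * \<beta>\<^sup>2 \<le> \<alpha> * \<gamma>" "4 * L * (\<alpha> * L + 2 * \<beta> + 2 * \<gamma> * K)\<^sup>2 \<le> \<beta>"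
    "2 * \<beta>\<^sup>2 + \<beta>\<^sup>2 * K\<^sup>2 / (2 * \<alpha>) + \<gamma> / 2 \<le> \<beta> * c / (8 * L)"
    and t: "t \<in> {0..T}"
  shows "L2_norm_torus (g t) \<le> exp 1 * L2_norm_torus (g 0) * exp (- (\<beta> * c / (48 * L)) * \<rho> * t)"
proof -
  define \<delta> where "\<delta> = \<beta> * c / (48 * L)"
  have nn: "0 \<le> L2_norm_torus (g 0)"
    using t by (auto simp: L2_norm_torus_def intro!: integral_nonneg integrable_continuous_real
        continuous_intros conts)
  have "\<beta> * c \<le> 1" using const c by (intro mult_le_one) auto
  then have \<delta>: "0 < \<delta>" "\<delta> \<le> 1" using const c L by (auto simp: \<delta>_def field_simps)
  show ?thesis
  proof (cases "1 \<le> \<rho> * t")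
    case True
    have "L2_norm_torus (g t) \<le> sqrt (exp (- (\<beta> * c / (24 * L)) * \<rho> * t) * integral {-pi..pi} (eA 0))"
      unfolding L2_norm_eq by (intro real_sqrt_le_mono mass_decay[OF const t True])
    also have "- (\<beta> * c / (24 * L)) * \<rho> * t = - \<delta> * \<rho> * t + - \<delta> * \<rho> * t"
      by (simp add: \<delta>_def field_simps)
    also have "sqrt (exp (- \<delta> * \<rho> * t + - \<delta> * \<rho> * t) * integral {-pi..pi} (eA 0))
        = exp (- \<delta> * \<rho> * t) * L2_norm_torus (g 0)"
      unfolding exp_add L2_norm_eq by (simp add: real_sqrt_mult)
    also have "\<dots> \<le> exp 1 * (exp (- \<delta> * \<rho> * t) * L2_norm_torus (g 0))"
      using nn mult_right_mono[of 1 "exp 1" "exp (- \<delta> * \<rho> * t) * L2_norm_torus (g 0)"] by simp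
    finally show ?thesis by (simp add: \<delta>_def mult_ac)
  next
    case False
    have "\<delta> * (\<rho> * t) \<le> 1" using \<delta> False \<rho> t by (intro mult_le_one[of \<delta> "\<rho> * t"]) auto
    then have "1 \<le> exp (1 + - \<delta> * \<rho> * t)" by (simp add: mult.assoc)
    then have "L2_norm_torus (g 0) \<le> exp (1 + - \<delta> * \<rho> * t) * L2_norm_torus (g 0)"
      using mult_right_mono[OF _ nn, of 1] by simp
    moreover have "L2_norm_torus (g t) \<le> L2_norm_torus (g 0)"
      using \<rho> \<sigma> by (intro L2_norm_antimono t) (auto simp: \<nu>_eq)
    ultimately have "L2_norm_torus (g t) \<le> exp (1 + - \<delta> * \<rho> * t) * L2_norm_torus (g 0)" by linarith
    then show ?thesis unfolding exp_add by (simp add: \<delta>_def mult_ac)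
  qed
qed

end

section \<open>Fourier modes of classical solutions\<close>

lemma continuous_on_compose_triple:
  fixes h :: "real \<Rightarrow> real \<Rightarrow> real \<Rightarrow> complex"
  assumes "continuous_on (S \<times> UNIV \<times> UNIV) (\<lambda>(t, x, y). h t x y)"
    and "continuous_on A a" "continuous_on A b" "continuous_on A c" "\<And>p. p \<in> A \<Longrightarrow> a p \<in> S"
  shows "continuous_on A (\<lambda>p. h (a p) (b p) (c p))"
proof -
  have "continuous_on A (\<lambda>p. (a p, b p, c p))" by (intro continuous_intros assms)
  from continuous_on_compose2[OF assms(1) this] assms(5) show ?thesis by (simp add: image_subset_iff)
qed

lemma jointly_cont_fourier_coeff:
  assumes "continuous_on (S \<times> UNIV \<times> UNIV) (\<lambda>(t, x, y). h t x y)"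
  shows "jointly_cont S (fourier_coeff k h)"
proof (rule jointly_contI)
  have "continuous_on (S \<times> UNIV) (\<lambda>p. integral (cbox (-pi) pi)
      (\<lambda>x. h (fst p) x (snd p) * exp (- \<i> * of_int k * of_real x)))"
    by (rule integral_continuous_on_param)
       (auto simp: split_beta intro!: continuous_intros continuous_on_compose_triple[OF assms])
  then show "continuous_on (S \<times> UNIV) (\<lambda>p. fourier_coeff k h (fst p) (snd p))"
    unfolding fourier_coeff_def by (intro continuous_intros) auto
qed

lemma fourier_coeff_deriv_time:
  assumes der: "\<And>t x y. t \<in> S \<Longrightarrow> ((\<lambda>s. h s x y) has_vector_derivative h' t x y) (at t within S)"
    and h: "continuous_on (S \<times> UNIV \<times> UNIV) (\<lambda>(t, x, y). h t x y)"
    and h': "continuous_on (S \<times> UNIV \<times> UNIV) (\<lambda>(t, x, y). h' t x y)"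
    and "convex S" "t \<in> S"
  shows "((\<lambda>s. fourier_coeff k h s y) has_vector_derivative fourier_coeff k h' t y) (at t within S)"
proof -
  have "((\<lambda>s. integral (cbox (-pi) pi) (\<lambda>x. h s x y * exp (- \<i> * of_int k * of_real x)))
      has_vector_derivative integral (cbox (-pi) pi) (\<lambda>x. h' t x y * exp (- \<i> * of_int k * of_real x)))
      (at t within S)"
    by (rule leibniz_rule_vector_derivative)
       (use assms(4,5) in \<open>auto simp: split_beta intro!: has_vector_derivative_mult_left der
          integrable_continuous_real continuous_intros
          continuous_on_compose_triple[OF h] continuous_on_compose_triple[OF h']\<close>)
  from has_vector_derivative_divide[OF this, of "of_real (2 * pi)"]
  show ?thesis by (simp add: fourier_coeff_def)
qed

lemma fourier_coeff_deriv_space: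
  assumes der: "\<And>x y. (h t x has_vector_derivative h' t x y) (at y)"
    and h: "continuous_on (S \<times> UNIV \<times> UNIV) (\<lambda>(t, x, y). h t x y)"
    and h': "continuous_on (S \<times> UNIV \<times> UNIV) (\<lambda>(t, x, y). h' t x y)"
    and t: "t \<in> S"
  shows "(fourier_coeff k h t has_vector_derivative fourier_coeff k h' t y) (at y)"
proof -
  have "((\<lambda>y. integral (cbox (-pi) pi) (\<lambda>x. h t x y * exp (- \<i> * of_int k * of_real x)))
      has_vector_derivative integral (cbox (-pi) pi) (\<lambda>x. h' t x y * exp (- \<i> * of_int k * of_real x)))
      (at y within UNIV)"
    by (rule leibniz_rule_vector_derivative)
       (use t in \<open>auto simp: split_beta intro!: has_vector_derivative_mult_left der
          integrable_continuous_real continuous_intros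
          continuous_on_compose_triple[OF h] continuous_on_compose_triple[OF h']\<close>)
  from has_vector_derivative_divide[OF this, of "of_real (2 * pi)"]
  show ?thesis by (simp add: fourier_coeff_def[abs_def])
qed

text \<open>The derivative of \<open>h\<close> times the exponential integrates to 0 over a period,
  because an integer frequency makes the exponential periodic too.\<close>

lemma fourier_coeff_deriv_x:
  assumes der: "\<And>x. ((\<lambda>x. h t x y) has_vector_derivative h' t x y) (at x)"
    and per: "periodic (\<lambda>x. h t x y)"
    and h: "continuous_on (S \<times> UNIV \<times> UNIV) (\<lambda>(t, x, y). h t x y)"
    and h': "continuous_on (S \<times> UNIV \<times> UNIV) (\<lambda>(t, x, y). h' t x y)" and t: "t \<in> S"
  shows "fourier_coeff k h' t y = \<i> * of_int k * fourier_coeff k h t y"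
proof -
  let ?e = "\<lambda>x::real. exp (- \<i> * of_int k * of_real x)"
  have e: "(?e has_vector_derivative - \<i> * of_int k * ?e x) (at x)" for x
    by (rule has_vector_derivative_real_field) (auto intro!: derivative_eq_intros)
  have "?e (x + 2 * pi) = ?e x" for x
  proof -
    have "?e (x + 2 * pi) = ?e x * exp ((2 * of_int (- k) * pi) * \<i>)"
      by (simp add: algebra_simps flip: exp_add)
    also have "exp ((2 * of_int (- k) * pi) * \<i>) = 1" by (rule exp_integer_2pi) auto
    finally show ?thesis by simp
  qed
  then have pe: "periodic (\<lambda>x. h t x y * ?e x)" using per by (simp add: periodic_def)
  have "((\<lambda>x. h t x y * ?e x) has_vector_derivative
      h t x y * (- \<i> * of_int k * ?e x) + h' t x y * ?e x) (at x)" for x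
    by (rule has_vector_derivative_mult[OF der e])
  from periodic_has_integral_deriv[OF pe this]
  have 1: "((\<lambda>x. h t x y * (- \<i> * of_int k * ?e x) + h' t x y * ?e x) has_integral 0) {-pi..pi}" .
  have 2: "((\<lambda>x. \<i> * of_int k * (h t x y * ?e x)) has_integral
      \<i> * of_int k * integral {-pi..pi} (\<lambda>x. h t x y * ?e x)) {-pi..pi}"
    by (intro has_integral_mult_right integrable_integral integrable_continuous_real continuous_intros
        continuous_on_compose_triple[OF h] t)
  have "((\<lambda>x. h' t x y * ?e x) has_integral
      \<i> * of_int k * integral {-pi..pi} (\<lambda>x. h t x y * ?e x)) {-pi..pi}"
    using has_integral_add[OF 1 2] by (simp add: algebra_simps)
  then show ?thesis by (simp add: fourier_coeff_def integral_unique)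
qed

lemma fourier_mode_of_classical_solution:
  assumes sol: "classical_solution \<sigma> \<nu> T V f0 f"
  obtains gt gy gyy where
    "\<And>t y. t \<in> {0..T} \<Longrightarrow> ((\<lambda>s. fourier_coeff k f s y) has_vector_derivative gt t y) (at t within {0..T})"
    "\<And>t y. t \<in> {0..T} \<Longrightarrow> (fourier_coeff k f t has_vector_derivative gy t y) (at y)"
    "\<And>t y. t \<in> {0..T} \<Longrightarrow> (gy t has_vector_derivative gyy t y) (at y)"
    "\<And>t. t \<in> {0..T} \<Longrightarrow> periodic (fourier_coeff k f t)"
    "jointly_cont {0..T} (fourier_coeff k f)" "jointly_cont {0..T} gt"
    "jointly_cont {0..T} gy" "jointly_cont {0..T} gyy"
    "\<And>t y. t \<in> {0..T} \<Longrightarrow> gt t y + \<i> * of_real (of_int k * V t y) * fourier_coeff k f t y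
      = of_real \<nu> * gyy t y - of_real (\<sigma> * \<nu> * (of_int k)\<^sup>2) * fourier_coeff k f t y"
proof -
  note sol' = sol[unfolded classical_solution_def]
  have per: "\<And>t x y. t \<in> {0..T} \<Longrightarrow> periodic (\<lambda>x. f t x y) \<and> periodic (f t x)"
    using conjunct1[OF sol'] by blast
  from conjunct2[OF conjunct2[OF sol']] obtain ft fx fxx fy fyy where
    cont: "\<forall>g \<in> {f, ft, fx, fy, fyy}. continuous_on ({0..T} \<times> UNIV \<times> UNIV) (\<lambda>(t, x, y). g t x y)" and
    cxx: "\<sigma> \<noteq> 0 \<longrightarrow> continuous_on ({0..T} \<times> UNIV \<times> UNIV) (\<lambda>(t, x, y). fxx t x y)" and
    der: "\<forall>t\<in>{0..T}. \<forall>x y.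
       ((\<lambda>s. f s x y) has_vector_derivative ft t x y) (at t within {0..T}) \<and>
       ((\<lambda>x. f t x y) has_vector_derivative fx t x y) (at x) \<and>
       (\<sigma> \<noteq> 0 \<longrightarrow> ((\<lambda>x. fx t x y) has_vector_derivative fxx t x y) (at x)) \<and>
       (f t x has_vector_derivative fy t x y) (at y) \<and>
       (fy t x has_vector_derivative fyy t x y) (at y) \<and>
       ft t x y + of_real (V t y) * fx t x y = of_real \<nu> * (of_real \<sigma> * fxx t x y + fyy t x y)"
    by (elim exE conjE) (rule that; assumption)
  have c: "continuous_on ({0..T} \<times> UNIV \<times> UNIV) (\<lambda>(t, x, y). f t x y)"
    "continuous_on ({0..T} \<times> UNIV \<times> UNIV) (\<lambda>(t, x, y). ft t x y)"
    "continuous_on ({0..T} \<times> UNIV \<times> UNIV) (\<lambda>(t, x, y). fx t x y)"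
    "continuous_on ({0..T} \<times> UNIV \<times> UNIV) (\<lambda>(t, x, y). fy t x y)"
    "continuous_on ({0..T} \<times> UNIV \<times> UNIV) (\<lambda>(t, x, y). fyy t x y)"
    using cont by auto
  show thesis
  proof
    fix t y assume t: "t \<in> {0..T}"
    show "((\<lambda>s. fourier_coeff k f s y) has_vector_derivative fourier_coeff k ft t y) (at t within {0..T})"
      by (rule fourier_coeff_deriv_time[OF _ c(1,2)]) (use der t in auto)
    show "(fourier_coeff k f t has_vector_derivative fourier_coeff k fy t y) (at y)"
      by (rule fourier_coeff_deriv_space[OF _ c(1,4) t]) (use der t in auto)
    show "(fourier_coeff k fy t has_vector_derivative fourier_coeff k fyy t y) (at y)"
      by (rule fourier_coeff_deriv_space[OF _ c(4,5) t]) (use der t in auto)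
    have fx: "fourier_coeff k fx t y = \<i> * of_int k * fourier_coeff k f t y"
      by (rule fourier_coeff_deriv_x[OF _ _ c(1,3) t]) (use der per t in auto)
    \<comment> \<open>For \<open>\<sigma> = 0\<close> no regularity of \<open>fxx\<close> is known;
      the product \<open>gxx\<close> is continuous in both cases, so the equation can be integrated
      termwise.\<close>
    define gxx where "gxx = (\<lambda>t x y. of_real \<sigma> * fxx t x y)"
    have gxx: "fourier_coeff k gxx t y = - of_real (\<sigma> * (of_int k)\<^sup>2) * fourier_coeff k f t y \<and>
      continuous_on ({0..T} \<times> UNIV \<times> UNIV) (\<lambda>(t, x, y). gxx t x y)"
    proof (cases "\<sigma> = 0")
      case True
      then show ?thesis by (simp add: gxx_def fourier_coeff_def)
    next
      case False
      have "periodic (\<lambda>x. fx t x y)"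
        by (rule periodic_vector_derivative[of "\<lambda>x. f t x y"]) (use der per t in auto)
      then have "fourier_coeff k fxx t y = \<i> * of_int k * fourier_coeff k fx t y"
        using der t False by (intro fourier_coeff_deriv_x[OF _ _ c(3) cxx[rule_format, OF False] t]) auto
      moreover have "fourier_coeff k gxx t y = of_real \<sigma> * fourier_coeff k fxx t y"
        by (simp add: gxx_def fourier_coeff_def mult.assoc)
      moreover have "continuous_on ({0..T} \<times> UNIV \<times> UNIV) (\<lambda>(t, x, y). gxx t x y)"
        using cxx[rule_format, OF False] by (auto simp: gxx_def split_beta intro!: continuous_intros)
      ultimately show ?thesis by (simp add: fx algebra_simps power2_eq_square)
    qed
    have I: "((\<lambda>x. h t x y * exp (- \<i> * of_int k * of_real x)) has_integral
        of_real (2 * pi) * fourier_coeff k h t y) {-pi..pi}"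
      if "continuous_on ({0..T} \<times> UNIV \<times> UNIV) (\<lambda>(t, x, y). h t x y)" for h
      unfolding fourier_coeff_def
      by (simp, intro integrable_integral integrable_continuous_real continuous_intros
          continuous_on_compose_triple[OF that] t)
    have "((\<lambda>x. (ft t x y + of_real (V t y) * fx t x y) * exp (- \<i> * of_int k * of_real x)) has_integral
        of_real (2 * pi) * fourier_coeff k ft t y + of_real (V t y) * (of_real (2 * pi) * fourier_coeff k fx t y))
        {-pi..pi}"
      using has_integral_add[OF I[OF c(2)] has_integral_mult_right[OF I[OF c(3)], of "of_real (V t y)"]]
      by (simp add: algebra_simps)
    moreover have "((\<lambda>x. (of_real \<nu> * (gxx t x y + fyy t x y)) * exp (- \<i> * of_int k * of_real x)) has_integral
        of_real \<nu> * (of_real (2 * pi) * fourier_coeff k gxx t y + of_real (2 * pi) * fourier_coeff k fyy t y))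
        {-pi..pi}"
      using has_integral_mult_right[OF has_integral_add[OF I[OF conjunct2[OF gxx]] I[OF c(5)]], of "of_real \<nu>"]
      by (simp add: algebra_simps)
    moreover have "ft t x y + of_real (V t y) * fx t x y = of_real \<nu> * (gxx t x y + fyy t x y)" for x
      using der t by (simp add: gxx_def)
    ultimately have "of_real (2 * pi) * fourier_coeff k ft t y
        + of_real (V t y) * (of_real (2 * pi) * fourier_coeff k fx t y)
      = of_real \<nu> * (of_real (2 * pi) * fourier_coeff k gxx t y + of_real (2 * pi) * fourier_coeff k fyy t y)"
      by (simp add: has_integral_unique)
    then have "of_real (2 * pi) * (fourier_coeff k ft t y + of_real (V t y) * fourier_coeff k fx t y)
      = of_real (2 * pi) * (of_real \<nu> * (fourier_coeff k gxx t y + fourier_coeff k fyy t y))"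
      by (simp only: distrib_left mult.left_commute)
    then have "fourier_coeff k ft t y + of_real (V t y) * fourier_coeff k fx t y
      = of_real \<nu> * (fourier_coeff k gxx t y + fourier_coeff k fyy t y)"
      by simp
    then show "fourier_coeff k ft t y + \<i> * of_real (of_int k * V t y) * fourier_coeff k f t y
      = of_real \<nu> * fourier_coeff k fyy t y - of_real (\<sigma> * \<nu> * (of_int k)\<^sup>2) * fourier_coeff k f t y"
      by (simp add: fx conjunct1[OF gxx] algebra_simps)
  next
    fix t assume "t \<in> {0..T}"
    then have "f t x (y + 2 * pi) = f t x y" for x y using per by (simp add: periodic_def)
    then show "periodic (fourier_coeff k f t)" by (simp add: periodic_def fourier_coeff_def)
  qed (intro jointly_cont_fourier_coeff c)+
qed

section \<open>Consequences of the structure assumptions\<close>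

lemma diff2_D2:
  fixes Z :: "real \<Rightarrow> real \<Rightarrow> real"
  assumes "diff2 S Z" "t \<in> S"
  shows "(Z t has_real_derivative D2 Z t y) (at y)"
  using assms unfolding diff2_def D2_def has_real_derivative_iff_has_vector_derivative
  by (simp flip: vector_derivative_works)

lemma diff1_D1:
  fixes Z :: "real \<Rightarrow> real \<Rightarrow> real"
  assumes "diff1 S Z" "t \<in> S"
  shows "((\<lambda>s. Z s y) has_real_derivative D1 S Z t y) (at t within S)"
  using assms unfolding diff1_def D1_def has_real_derivative_iff_has_vector_derivative
  by (simp flip: vector_derivative_works)

text \<open>The set where the bound fails inside the open interval is open and negligible, hence
  empty; passing to the closure supplies the end points.\<close>

lemma continuous_AE_le_imp_le:
  fixes h :: "real \<Rightarrow> real"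
  assumes "a < b" and cont: "continuous_on {a..b} h"
    and ae: "AE x in lebesgue_on {a..b}. h x \<le> M" and x: "x \<in> {a..b}"
  shows "h x \<le> M"
proof -
  define S where "S = {x \<in> {a<..<b}. M < h x}"
  have "{x \<in> {a<..<b}. h x \<in> {M<..}} = {a<..<b} \<inter> h -` {M<..}" by auto
  moreover have "open ({a<..<b} \<inter> h -` {M<..})"
    by (rule continuous_open_preimage[OF continuous_on_subset[OF cont]]) auto
  ultimately have "open S" by (simp add: S_def)
  have "AE x in lebesgue. x \<in> {a..b} \<longrightarrow> h x \<le> M"
    using ae by (subst (asm) AE_restrict_space_iff) auto
  then have "negligible {x. \<not> (x \<in> {a..b} \<longrightarrow> h x \<le> M)}"
    by (simp add: negligible_iff_null_sets completion.AE_iff_null_sets)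
  then have "negligible S"
    by (rule negligible_subset) (auto simp: S_def)
  with \<open>open S\<close> have "S = {}" using open_not_negligible by blast
  then have "\<And>x. x \<in> {a<..<b} \<Longrightarrow> h x \<le> M" unfolding S_def by force
  moreover have "closure {a<..<b} = {a..b}" using \<open>a < b\<close> by simp
  ultimately show ?thesis
    using continuous_le_on_closure[of "{a<..<b}" h x M] cont x by simp
qed

lemma Linf_norm_nonneg: "0 \<le> Linf_norm h"
proof -
  have "esssup (lebesgue_on {-pi..pi}) (\<lambda>_. 0 :: ereal) = 0"
    by (rule esssup_const) (auto simp: emeasure_restrict_space)
  then show ?thesis
    unfolding Linf_norm_def using esssup_mono[of "\<lambda>_. 0" "lebesgue_on {-pi..pi}" "\<lambda>y. ereal \<bar>h y\<bar>"] by simp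
qed

lemma Linf_Wminf_norm_nonneg:
  assumes "0 < T"
  shows "0 \<le> Linf_Wminf_norm T m Z"
proof -
  have "esssup (lebesgue_on {0..T}) (\<lambda>_. 0 :: ereal) = 0"
    by (rule esssup_const) (use assms in \<open>auto simp: emeasure_restrict_space\<close>)
  then show ?thesis
    unfolding Linf_Wminf_norm_def
    using esssup_mono[of "\<lambda>_. 0" "lebesgue_on {0..T}" "\<lambda>t. \<Sum>j\<le>m. Linf_norm ((D2 ^^ j) Z t)"]
    by (simp add: sum_nonneg Linf_norm_nonneg)
qed

text \<open>The essential suprema in \<open>t\<close> and \<open>y\<close> are nested, so continuity
  is used twice: in \<open>t\<close> for the given \<open>y\<close>, which reduces the claim to
  almost every \<open>t\<close>, and then in \<open>y\<close>. The summands over \<open>j\<close>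
  are nonnegative, so a single one can be isolated.\<close>

lemma Linf_Wminf_norm_bound:
  assumes T: "0 < T" and cont: "jointly_cont {0..T} ((D2 ^^ j) Z)" and j: "j \<le> m"
    and le: "Linf_Wminf_norm T m Z \<le> ereal M" and t: "t \<in> {0..T}" and y: "y \<in> {-pi..pi}"
  shows "\<bar>(D2 ^^ j) Z t y\<bar> \<le> M"
proof (rule continuous_AE_le_imp_le[OF T _ _ t])
  show "continuous_on {0..T} (\<lambda>t. \<bar>(D2 ^^ j) Z t y\<bar>)"
    by (intro continuous_intros jointly_cont_compose[OF cont])
  have "AE t in lebesgue_on {0..T}. (\<Sum>j\<le>m. Linf_norm ((D2 ^^ j) Z t)) \<le> ereal M"
    by (rule eventually_mono[OF esssup_AE]) (use le in \<open>auto simp: Linf_Wminf_norm_def intro: order_trans\<close>)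
  moreover have "AE t in lebesgue_on {0..T}. t \<in> {0..T}"
    by (rule AE_I2) simp
  ultimately show "AE t in lebesgue_on {0..T}. \<bar>(D2 ^^ j) Z t y\<bar> \<le> M"
  proof eventually_elim
    case (elim t)
    show ?case
    proof (rule continuous_AE_le_imp_le[OF _ _ _ y])
      show "continuous_on {-pi..pi} (\<lambda>y. \<bar>(D2 ^^ j) Z t y\<bar>)"
        using elim by (intro continuous_intros jointly_cont_compose[OF cont])
      have "Linf_norm ((D2 ^^ j) Z t) \<le> (\<Sum>j\<le>m. Linf_norm ((D2 ^^ j) Z t))"
        using j by (intro sum_nonneg_leq_bound[OF _ _ refl] Linf_norm_nonneg) auto
      with elim have "Linf_norm ((D2 ^^ j) Z t) \<le> ereal M" by simp
      then have le: "esssup (lebesgue_on {-pi..pi}) (\<lambda>y. ereal \<bar>(D2 ^^ j) Z t y\<bar>) \<le> ereal M"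
        by (simp add: Linf_norm_def)
      show "AE y in lebesgue_on {-pi..pi}. \<bar>(D2 ^^ j) Z t y\<bar> \<le> M"
      proof (rule eventually_mono[OF esssup_AE])
        fix y assume "ereal \<bar>(D2 ^^ j) Z t y\<bar> \<le> esssup (lebesgue_on {-pi..pi}) (\<lambda>y. ereal \<bar>(D2 ^^ j) Z t y\<bar>)"
        from order_trans[OF this le] show "\<bar>(D2 ^^ j) Z t y\<bar> \<le> M" by simp
      qed
    qed simp
  qed
qed

text \<open>Some copy \<open>p\<close> of \<open>z\<close> lies within \<open>\<eta>\<close> of
  \<open>y\<close>, and the shift by \<open>2 * \<eta>\<close> leads at least \<open>\<eta>\<close>
  away from it. The other copies are at least \<open>2 * pi\<close> from \<open>p\<close>, and
  \<open>2 * pi - 3 * \<eta>\<close> exceeds \<open>\<eta>\<close> when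
  \<open>\<eta> \<le> 1\<close>.\<close>

lemma torus_dist_shift:
  assumes "torus_dist y z < \<eta>" "\<eta> \<le> 1"
  shows "\<eta> \<le> torus_dist (y + 2 * \<eta>) z" "torus_dist (y + 2 * \<eta>) z < 3 * \<eta>"
proof -
  have ne: "torus_class z \<noteq> {}" by (simp add: torus_class_def)
  have "0 < \<eta>" using assms(1) infdist_nonneg[of y "torus_class z"] by (simp add: torus_dist_def)
  then show "torus_dist (y + 2 * \<eta>) z < 3 * \<eta>"
    using infdist_triangle[of "y + 2 * \<eta>" "torus_class z" y] assms(1)
    by (simp add: torus_dist_def dist_real_def)
  from assms(1) ne obtain p where "p \<in> torus_class z" and p: "dist y p < \<eta>"
    using cInf_lessD[of "dist y ` torus_class z" \<eta>] by (auto simp: torus_dist_def infdist_def)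
  then obtain n :: int where n: "p = z + 2 * pi * of_int n" by (auto simp: torus_class_def)
  have "\<eta> \<le> dist (y + 2 * \<eta>) x" if "x \<in> torus_class z" for x
  proof -
    from that obtain l :: int where l: "x = z + 2 * pi * of_int l" by (auto simp: torus_class_def)
    show ?thesis
    proof (cases "l = n")
      case True
      then show ?thesis using p n l by (simp add: dist_real_def)
    next
      case False
      then have "1 \<le> \<bar>real_of_int (l - n)\<bar>" by linarith
      then have "2 * pi * 1 \<le> 2 * pi * \<bar>real_of_int (l - n)\<bar>" by (intro mult_left_mono) auto
      also have "\<dots> = \<bar>2 * pi * real_of_int (l - n)\<bar>" by (simp add: abs_mult)
      also have "2 * pi * real_of_int (l - n) = x - p" by (simp add: n l algebra_simps)
      finally have "2 * pi \<le> \<bar>x - p\<bar>" by simp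
      then show ?thesis using p pi_gt3 assms(2) by (simp add: dist_real_def)
    qed
  qed
  then show "\<eta> \<le> torus_dist (y + 2 * \<eta>) z"
    unfolding torus_dist_def infdist_def using ne by (auto intro: cINF_greatest)
qed

text \<open>Supplies the hypothesis \<open>shift\<close> of
  \<open>degenerate_weight_interpolation\<close>. A bad point is closer than \<open>\<eta>\<close>
  to a critical point; its translate is at distance between \<open>\<eta>\<close> and
  \<open>3 * \<eta> \<le> r\<close>, so it stays in the same ball, where the quadratic lower bound
  applies. \<open>C0 + C1\<^sup>2\<close> dominates the constants of both regions.\<close>

lemma shape_shift:
  assumes shape: "shape_assumption r C0 C1 N T V U ys" and t: "t \<in> {0..T}"
    and C: "1 < C0" "1 < C1" and \<eta>: "0 < \<eta>" "\<eta> \<le> 1" "3 * \<eta> \<le> r"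
  shows "inverse (C0 + C1\<^sup>2) * \<eta>\<^sup>2 \<le> (D2 U t y)\<^sup>2 \<or> inverse (C0 + C1\<^sup>2) * \<eta>\<^sup>2 \<le> (D2 U t (y + 2 * \<eta>))\<^sup>2"
proof -
  have m: "inverse (C0 + C1\<^sup>2) \<le> inverse C0" "inverse (C0 + C1\<^sup>2) \<le> (inverse C1)\<^sup>2"
    using C by (auto simp: power_inverse intro!: le_imp_inverse_le)
  have near: "inverse C0 * (torus_dist y (ys i t))\<^sup>2 \<le> (D2 U t y)\<^sup>2"
    if "i \<in> {1..N}" "torus_dist y (ys i t) < r" for i y
    using shape t that unfolding shape_assumption_def torus_ball_def by force
  have far: "inverse C1 \<le> \<bar>D2 U t y\<bar>" if "\<And>i. i \<in> {1..N} \<Longrightarrow> \<not> torus_dist y (ys i t) < r" for y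
    using shape t that unfolding shape_assumption_def torus_ball_def by simp
  have use_near: "inverse (C0 + C1\<^sup>2) * \<eta>\<^sup>2 \<le> (D2 U t y)\<^sup>2"
    if "i \<in> {1..N}" "torus_dist y (ys i t) < r" "\<eta> \<le> torus_dist y (ys i t)" for i y
  proof -
    have "inverse (C0 + C1\<^sup>2) * \<eta>\<^sup>2 \<le> inverse C0 * (torus_dist y (ys i t))\<^sup>2"
      using m \<eta> that C by (intro mult_mono power_mono) auto
    then show ?thesis using near[OF that(1,2)] by linarith
  qed
  show ?thesis
  proof (cases "\<exists>i\<in>{1..N}. torus_dist y (ys i t) < r")
    case True
    then obtain i where i: "i \<in> {1..N}" "torus_dist y (ys i t) < r" by blast
    show ?thesis
    proof (cases "\<eta> \<le> torus_dist y (ys i t)")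
      case True
      then show ?thesis using use_near[OF i] by blast
    next
      case False
      then have "torus_dist y (ys i t) < \<eta>" by simp
      from torus_dist_shift[OF this \<eta>(2)] show ?thesis
        using use_near[OF i(1), of "y + 2 * \<eta>"] \<eta>(3) by auto
    qed
  next
    case False
    then have "(inverse C1)\<^sup>2 \<le> \<bar>D2 U t y\<bar>\<^sup>2"
      using far[of y] C by (intro power_mono) auto
    moreover have "inverse (C0 + C1\<^sup>2) * \<eta>\<^sup>2 \<le> inverse (C0 + C1\<^sup>2) * 1"
      using \<eta> C by (intro mult_left_mono) (auto simp: power_le_one intro: add_nonneg_nonneg)
    ultimately show ?thesis using m(2) by simp
  qed
qed

text \<open>Inside a ball both derivatives are comparable with the distance to the same critical
  point, outside both lie between \<open>1 / C1\<close> and \<open>C1\<close>; the ratio is thus at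
  most \<open>C0\<close> or \<open>C1\<^sup>2\<close>.\<close>

lemma shape_comparison:
  assumes shape: "shape_assumption r C0 C1 N T V U ys" and t: "t \<in> {0..T}"
    and C: "1 < C0" "1 < C1" and Z: "Z \<in> {V, U}" "W \<in> {V, U}"
  shows "\<bar>D2 Z t y\<bar> \<le> (C0 + C1\<^sup>2) * \<bar>D2 W t y\<bar>"
proof (cases "\<exists>i\<in>{1..N}. y \<in> torus_ball (ys i t) r")
  case True
  then obtain i where i: "i \<in> {1..N}" "y \<in> torus_ball (ys i t) r" by blast
  let ?d = "(torus_dist y (ys i t))\<^sup>2"
  have "\<bar>D2 Z t y\<bar>\<^sup>2 \<le> C0 * ?d" "inverse C0 * ?d \<le> \<bar>D2 W t y\<bar>\<^sup>2"
    using shape t i Z unfolding shape_assumption_def by blast+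
  moreover have "C0 * ?d = C0\<^sup>2 * (inverse C0 * ?d)" using C by (simp add: power2_eq_square)
  ultimately have "\<bar>D2 Z t y\<bar>\<^sup>2 \<le> C0\<^sup>2 * \<bar>D2 W t y\<bar>\<^sup>2"
    using mult_left_mono[of "inverse C0 * ?d" "\<bar>D2 W t y\<bar>\<^sup>2" "C0\<^sup>2"] by simp
  then have "\<bar>D2 Z t y\<bar>\<^sup>2 \<le> (C0 * \<bar>D2 W t y\<bar>)\<^sup>2" by (simp only: power_mult_distrib)
  then have "\<bar>D2 Z t y\<bar> \<le> C0 * \<bar>D2 W t y\<bar>" by (rule power2_le_imp_le) (use C in simp)
  also have "\<dots> \<le> (C0 + C1\<^sup>2) * \<bar>D2 W t y\<bar>" by (intro mult_right_mono) auto
  finally show ?thesis .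
next
  case False
  then have "y \<notin> (\<Union>i\<in>{1..N}. torus_ball (ys i t) r)" by blast
  then have 1: "\<bar>D2 Z t y\<bar> \<le> C1" "inverse C1 \<le> \<bar>D2 W t y\<bar>"
    using shape t Z unfolding shape_assumption_def by blast+
  have "C1 = C1\<^sup>2 * inverse C1" using C by (simp add: power2_eq_square)
  also have "\<dots> \<le> (C0 + C1\<^sup>2) * \<bar>D2 W t y\<bar>" using 1 C by (intro mult_mono) auto
  finally show ?thesis using 1 by linarith
qed

section \<open>Assembly of the hypotheses and the decay estimate\<close>

lemma fourier_mode_is_shear_mode:
  assumes "\<forall>t\<in>{0..T}. periodic (V t)" "C_diff 2 {0..T} V" "phase_assumption C N \<nu> T V U ys"
    and "classical_solution \<sigma> \<nu> T V f0 f"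
  obtains gt gy gyy where "shear_mode T (of_int k) \<nu> \<sigma> V (D2 V) (D2 U) (D2 (D2 U)) (D1 {0..T} (D2 U))
    (fourier_coeff k f) gt gy gyy"
proof -
  have V: "jointly_cont {0..T} V" "jointly_cont {0..T} (D2 V)" "diff2 {0..T} V"
    using assms(2) by (auto simp: numeral_2_eq_2)
  have U: "diff2 {0..T} U" "diff2 {0..T} (D2 U)" "diff1 {0..T} (D2 U)"
    "jointly_cont {0..T} (D2 U)" "jointly_cont {0..T} (D2 (D2 U))" "jointly_cont {0..T} (D1 {0..T} (D2 U))"
    "\<And>t. t \<in> {0..T} \<Longrightarrow> periodic (U t)"
    using assms(3) by (auto simp: phase_assumption_def C1t_C2y_def)
  have "periodic (D2 U t)" if "t \<in> {0..T}" for t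
    using diff2_D2[OF U(1) that, unfolded has_real_derivative_iff_has_vector_derivative]
    by (rule periodic_vector_derivative[OF U(7)[OF that]])
  moreover obtain gt gy gyy where
    "\<And>t y. t \<in> {0..T} \<Longrightarrow> ((\<lambda>s. fourier_coeff k f s y) has_vector_derivative gt t y) (at t within {0..T})"
    "\<And>t y. t \<in> {0..T} \<Longrightarrow> (fourier_coeff k f t has_vector_derivative gy t y) (at y)"
    "\<And>t y. t \<in> {0..T} \<Longrightarrow> (gy t has_vector_derivative gyy t y) (at y)"
    "\<And>t. t \<in> {0..T} \<Longrightarrow> periodic (fourier_coeff k f t)"
    "jointly_cont {0..T} (fourier_coeff k f)" "jointly_cont {0..T} gt"
    "jointly_cont {0..T} gy" "jointly_cont {0..T} gyy"
    "\<And>t y. t \<in> {0..T} \<Longrightarrow> gt t y + \<i> * of_real (of_int k * V t y) * fourier_coeff k f t y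
      = of_real \<nu> * gyy t y - of_real (\<sigma> * \<nu> * (of_int k)\<^sup>2) * fourier_coeff k f t y"
    using fourier_mode_of_classical_solution[OF assms(4), of k] by blast
  ultimately have "shear_mode T (of_int k) \<nu> \<sigma> V (D2 V) (D2 U) (D2 (D2 U)) (D1 {0..T} (D2 U))
    (fourier_coeff k f) gt gy gyy"
    using assms(1) V U by unfold_locales (auto intro: diff2_D2 diff1_D1)
  then show thesis by (rule that)
qed

text \<open>\<open>\<bar>C\<bar>\<close> replaces \<open>C\<close> because the weights are fixed
  from \<open>C\<close> before any flow is given, and their construction asks for
  \<open>0 \<le> K\<close>.\<close>

lemma structure_bounds:
  assumes T: "0 < T" and phase: "phase_assumption C N \<nu> T V U ys"
    and t: "t \<in> {0..T}" and y: "y \<in> {-pi..pi}"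
  shows "\<bar>D2 (D2 U) t y\<bar> \<le> \<bar>C\<bar>" "\<bar>D1 {0..T} (D2 U) t y\<bar> \<le> \<nu> powr (3/4)"
proof -
  from phase have U: "jointly_cont {0..T} (D2 (D2 U))" "jointly_cont {0..T} (D1 {0..T} (D2 U))"
    and le: "Linf_Wminf_norm T 0 (D1 {0..T} (D2 U)) \<le> ereal (\<nu> powr (3/4))"
      "Linf_Wminf_norm T 2 V + Linf_Wminf_norm T 2 U < ereal C"
    by (auto simp: phase_assumption_def C1t_C2y_def)
  have "Linf_Wminf_norm T 2 U \<le> Linf_Wminf_norm T 2 V + Linf_Wminf_norm T 2 U"
    using Linf_Wminf_norm_nonneg[OF T, of 2 V] by (simp add: add_increasing)
  then have "Linf_Wminf_norm T 2 U \<le> ereal C" using le(2) by simp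
  from Linf_Wminf_norm_bound[OF T _ order_refl this t y] U(1) show "\<bar>D2 (D2 U) t y\<bar> \<le> \<bar>C\<bar>"
    by (simp add: numeral_2_eq_2)
  from Linf_Wminf_norm_bound[OF T _ order_refl le(1) t y] U(2)
  show "\<bar>D1 {0..T} (D2 U) t y\<bar> \<le> \<nu> powr (3/4)" by simp
qed

text \<open>Since \<open>\<rho> * q = \<nu> powr (3/4) * \<kappa> powr (1/4)\<close>, the hypothesis
  on the mixed derivative of \<open>U\<close> is strong enough for every nonzero mode.
  \<open>q \<le> 1\<close> keeps the critical layer inside the balls.\<close>

lemma critical_layer_scales:
  fixes \<nu> \<kappa> :: real
  assumes "0 < \<nu>" "\<nu> \<le> 1" "1 \<le> \<kappa>"
  defines "\<rho> \<equiv> \<nu> powr (1/2) * \<kappa> powr (1/2)" and "q \<equiv> (\<nu> / \<kappa>) powr (1/4)"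
  shows "0 < \<rho>" "0 < q" "q \<le> 1" "\<nu> = \<rho> * q\<^sup>2" "\<kappa> = \<rho> / q\<^sup>2" "\<nu> powr (3/4) \<le> \<rho> * q"
proof -
  have q2: "q\<^sup>2 = \<nu> powr (1/2) / \<kappa> powr (1/2)"
    using assms by (simp add: q_def powr_divide power_divide flip: powr_powr powr_numeral)
      (simp add: powr_powr)
  have sq: "x powr (1/2) * x powr (1/2) = x" if "0 < x" for x :: real
    using that by (simp flip: powr_add)
  show "0 < \<rho>" "0 < q" using assms by (auto simp: \<rho>_def q_def)
  show "q \<le> 1" unfolding q_def using assms by (intro powr_le1) (auto simp: field_simps)
  show "\<nu> = \<rho> * q\<^sup>2" "\<kappa> = \<rho> / q\<^sup>2"
    using assms sq[of \<nu>] sq[of \<kappa>] unfolding q2 \<rho>_def by (simp_all add: field_simps)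
  have "\<nu> powr (3/4) = \<nu> powr (1/2) * \<nu> powr (1/4) * 1" by (simp flip: powr_add)
  also have "\<dots> \<le> \<nu> powr (1/2) * \<nu> powr (1/4) * \<kappa> powr (1/4)"
    using assms by (intro mult_left_mono ge_one_powr_ge_zero) auto
  also have "\<dots> = \<nu> powr (1/2) * \<nu> powr (1/4) * (\<kappa> powr (1/2) / \<kappa> powr (1/4))"
    by (simp flip: powr_diff)
  also have "\<dots> = \<rho> * q" using assms by (simp add: \<rho>_def q_def powr_divide)
  finally show "\<nu> powr (3/4) \<le> \<rho> * q" .
qed

text \<open>\<open>\<nu>0\<close> and \<open>\<delta>\<close> are chosen before the flows, the
  critical points, \<open>T\<close>, \<open>\<nu>\<close> and \<open>\<sigma>\<close>, so they
  depend only on the parameters of the structure conditions.\<close>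

theorem theorem1p2:
  fixes C r C0 C1 :: real and N :: nat
  assumes "0 < r" and "1 < C0" and "1 < C1"
  shows "\<exists>\<nu>0>0. \<exists>\<delta>>0. \<forall>\<sigma>\<in>{0, 1}. \<forall>\<nu> T :: real.
    \<forall>(V :: real \<Rightarrow> real \<Rightarrow> real) (U :: real \<Rightarrow> real \<Rightarrow> real) (ys :: nat \<Rightarrow> real \<Rightarrow> real)
      (f0 :: real \<Rightarrow> real \<Rightarrow> complex) (f :: real \<Rightarrow> real \<Rightarrow> real \<Rightarrow> complex).
      0 < \<nu> \<and> \<nu> \<le> \<nu>0 \<and> 0 < T \<and>
      (\<forall>t\<in>{0..T}. periodic (V t)) \<and> C_diff 2 {0..T} V \<and>
      phase_assumption C N \<nu> T V U ys \<and>
      shape_assumption r C0 C1 N T V U ys \<and>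
      smooth_on_torus2 f0 \<and> classical_solution \<sigma> \<nu> T V f0 f \<longrightarrow>
      (\<forall>k::int. \<forall>t\<in>{0..T}.
        L2_norm_torus (fourier_coeff k f t) \<le>
          exp 1 * L2_norm_torus (fourier_coeff k f 0) *
          exp (- \<delta> * \<nu> powr (1/2) * \<bar>real_of_int k\<bar> powr (1/2) * t))"
proof -
  define L where "L = C0 + C1\<^sup>2"
  define \<eta>0 where "\<eta>0 = min 1 (r / 3)"
  \<comment> \<open>\<open>D\<close> majorises both coefficients that
    \<open>degenerate_weight_interpolation\<close> yields for
    \<open>m = inverse L * \<eta>\<^sup>2\<close> and \<open>\<eta> = \<eta>0 * q\<close> after
    division by \<open>q\<^sup>2\<close>; dividing by \<open>D\<close> gives the constant
    \<open>c\<close> of \<open>spectral\<close>.\<close>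
  define D where "D = 3 + 8 * inverse L * \<eta>0 ^ 4"
  define c where "c = inverse L * \<eta>0\<^sup>2 / D"
  have L: "1 \<le> L" using assms zero_le_power2[of C1] unfolding L_def by linarith
  have \<eta>0: "0 < \<eta>0" "\<eta>0 \<le> 1" "3 * \<eta>0 \<le> r" using assms by (auto simp: \<eta>0_def)
  have D: "3 \<le> D" using L \<eta>0 by (simp add: D_def)
  have "inverse L * \<eta>0\<^sup>2 \<le> 1"
    using L \<eta>0 by (intro mult_le_one) (auto simp: power_le_one inverse_le_1_iff)
  then have c: "0 < c" "c \<le> 1" using L \<eta>0 D by (simp_all add: c_def divide_le_eq_1_pos)
  obtain \<alpha> \<beta> \<gamma> where const: "0 < \<alpha>" "0 < \<beta>" "0 < \<gamma>" "\<alpha> \<le> 1/4" "\<beta> \<le> 1" "\<gamma> \<le> 1"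
    "12 * \<gamma> * L \<le> \<beta>" "2 * \<beta>\<^sup>2 \<le> \<alpha> * \<gamma>" "4 * L * (\<alpha> * L + 2 * \<beta> + 2 * \<gamma> * \<bar>C\<bar>)\<^sup>2 \<le> \<beta>"
    "2 * \<beta>\<^sup>2 + \<beta>\<^sup>2 * \<bar>C\<bar>\<^sup>2 / (2 * \<alpha>) + \<gamma> / 2 \<le> \<beta> * c / (8 * L)"
    using hypocoercive_constants[OF L abs_ge_zero c, of C] by blast
  define \<delta> where "\<delta> = \<beta> * c / (48 * L)"
  have decay: "L2_norm_torus (fourier_coeff k f t) \<le> exp 1 * L2_norm_torus (fourier_coeff k f 0) *
      exp (- \<delta> * \<nu> powr (1/2) * \<bar>real_of_int k\<bar> powr (1/2) * t)"
    if \<sigma>: "\<sigma> \<in> {0, 1 :: real}" and \<nu>: "0 < \<nu>" "\<nu> \<le> 1" and T: "0 < T"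
      and perV: "\<forall>t\<in>{0..T}. periodic (V t)" and V: "C_diff 2 {0..T} V"
      and phase: "phase_assumption C N \<nu> T V U ys" and shape: "shape_assumption r C0 C1 N T V U ys"
      and sol: "classical_solution \<sigma> \<nu> T V f0 f" and t: "t \<in> {0..T}"
    for \<sigma> \<nu> T t :: real and V U ys f0 f k
  proof -
    have \<sigma>0: "0 \<le> \<sigma>" using \<sigma> by auto
    obtain gt gy gyy where "shear_mode T (of_int k) \<nu> \<sigma> V (D2 V) (D2 U) (D2 (D2 U)) (D1 {0..T} (D2 U))
        (fourier_coeff k f) gt gy gyy"
      using fourier_mode_is_shear_mode[OF perV V phase sol] .
    then interpret shear_mode T "of_int k" \<nu> \<sigma> V "D2 V" "D2 U" "D2 (D2 U)" "D1 {0..T} (D2 U)"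
        "fourier_coeff k f" gt gy gyy .
    show ?thesis
    proof (cases "k = 0")
      \<comment> \<open>\<open>0 powr (1/2)\<close> is 0, so the claimed rate vanishes and
        monotonicity of the norm is enough.\<close>
      case True
      have "0 \<le> L2_norm_torus (fourier_coeff k f 0)"
        using T by (auto simp: L2_norm_torus_def intro!: integral_nonneg integrable_continuous_real
            continuous_intros conts)
      then have "L2_norm_torus (fourier_coeff k f 0) \<le> exp 1 * L2_norm_torus (fourier_coeff k f 0)"
        using mult_right_mono[of 1 "exp 1" "L2_norm_torus (fourier_coeff k f 0)"] by simp
      then show ?thesis using L2_norm_antimono[OF t less_imp_le[OF \<nu>(1)] \<sigma>0] True by simp
    next
      case False
      define \<kappa> where "\<kappa> = \<bar>real_of_int k\<bar>"
      define \<rho> where "\<rho> = \<nu> powr (1/2) * \<kappa> powr (1/2)"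
      define q where "q = (\<nu> / \<kappa>) powr (1/4)"
      have "1 \<le> \<kappa>" using False unfolding \<kappa>_def by linarith
      note scales = critical_layer_scales[OF \<nu> this, folded \<rho>_def q_def]
      interpret enhanced_shear_mode T "of_int k" \<nu> \<sigma> V "D2 V" "D2 U" "D2 (D2 U)" "D1 {0..T} (D2 U)"
          "fourier_coeff k f" gt gy gyy \<rho> q "sgn (of_int k)" L "\<bar>C\<bar>" c
      proof
        show "0 < \<rho>" "0 < q" "\<nu> = \<rho> * q\<^sup>2" "0 \<le> \<sigma>" "1 \<le> L" "0 \<le> \<bar>C\<bar>" "0 < c" "c \<le> 1"
          using scales \<sigma>0 L c by auto
        have "of_int k = sgn (of_int k) * \<kappa>" by (simp add: \<kappa>_def sgn_mult_abs)
        then show "of_int k = sgn (of_int k) * \<rho> / q\<^sup>2" using scales(5) by simp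
        show "\<bar>sgn (real_of_int k)\<bar> = 1" using False by (simp add: abs_sgn_eq)
      next
        fix t y assume t: "t \<in> {0..T}"
        show "\<bar>D2 V t y\<bar> \<le> L * \<bar>D2 U t y\<bar>"
          unfolding L_def by (rule shape_comparison[OF shape t assms(2,3)]) auto
        \<comment> \<open>Comparison of the profiles gives the bound with absolute values; the sign
          condition of the phase assumption then removes them.\<close>
        have "\<bar>D2 U t y\<bar> * \<bar>D2 U t y\<bar> \<le> \<bar>D2 U t y\<bar> * (L * \<bar>D2 V t y\<bar>)"
          unfolding L_def by (intro mult_left_mono shape_comparison[OF shape t assms(2,3)]) auto
        also have "\<dots> = L * \<bar>D2 V t y * D2 U t y\<bar>" by (simp add: abs_mult)
        also have "\<bar>D2 V t y * D2 U t y\<bar> = D2 U t y * D2 V t y"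
          using phase t by (simp add: phase_assumption_def mult.commute)
        finally show "(D2 U t y)\<^sup>2 \<le> L * (D2 U t y * D2 V t y)" by (simp add: power2_eq_square)
        show "\<bar>D2 (D2 U) t y\<bar> \<le> \<bar>C\<bar>" "\<bar>D1 {0..T} (D2 U) t y\<bar> \<le> \<rho> * q" if "y \<in> {-pi..pi}"
          using structure_bounds[OF T phase t that] scales(6) by auto
      next
        fix t assume t: "t \<in> {0..T}"
        let ?g = "\<lambda>y. (norm (fourier_coeff k f t y))\<^sup>2"
        let ?A = "integral {-pi..pi} ?g" and ?B = "integral {-pi..pi} (\<lambda>y. (norm (gy t y))\<^sup>2)"
          and ?E = "integral {-pi..pi} (\<lambda>y. (D2 U t y)\<^sup>2 * ?g y)"
        \<comment> \<open>At a width proportional to \<open>q\<close>, the lower bound of order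
          \<open>\<eta>\<^sup>2\<close> and the derivative cost of order \<open>\<eta> ^ 4\<close>
          become, after division by \<open>q\<^sup>2\<close>, of orders 1 and
          \<open>q\<^sup>2\<close>, as in \<open>spectral\<close>.\<close>
        define \<eta> where "\<eta> = \<eta>0 * q"
        have \<eta>: "0 < \<eta>" "\<eta> \<le> \<eta>0" using \<eta>0 scales(2,3) by (auto simp: \<eta>_def mult_left_le)
        have "\<eta> \<le> pi" using \<eta> \<eta>0 pi_gt3 by linarith
        have "inverse L * \<eta>\<^sup>2 * ?A \<le> 3 * ?E + 8 * (inverse L * \<eta>\<^sup>2) * \<eta>\<^sup>2 * ?B"
        proof (rule degenerate_weight_interpolation[OF g_y[OF t] _ periodic_g[OF t] _ periodic_Uy[OF t]])
          show "inverse L * \<eta>\<^sup>2 \<le> (D2 U t y)\<^sup>2 \<or> inverse L * \<eta>\<^sup>2 \<le> (D2 U t (y + 2 * \<eta>))\<^sup>2" for y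
            unfolding L_def by (rule shape_shift[OF shape t assms(2,3)]) (use \<eta> \<eta>0 in auto)
        qed (use t L \<eta> \<open>\<eta> \<le> pi\<close> in \<open>auto intro!: conts continuous_intros\<close>)
        then have "q\<^sup>2 * (inverse L * \<eta>0\<^sup>2 * ?A) \<le> q\<^sup>2 * (3 * (?E / q\<^sup>2) + 8 * inverse L * \<eta>0 ^ 4 * (q\<^sup>2 * ?B))"
          using scales(2) by (simp add: \<eta>_def algebra_simps power2_eq_square power4_eq_xxxx)
        then have "inverse L * \<eta>0\<^sup>2 * ?A \<le> 3 * (?E / q\<^sup>2) + 8 * inverse L * \<eta>0 ^ 4 * (q\<^sup>2 * ?B)"
          using scales(2) by (simp only: mult_le_cancel_left_pos zero_less_power)
        also have "\<dots> \<le> D * (?E / q\<^sup>2) + D * (q\<^sup>2 * ?B)"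
        proof (intro add_mono mult_right_mono)
          have "0 \<le> ?E" "0 \<le> ?B"
            using t by (auto intro!: integral_nonneg integrable_continuous_real continuous_intros conts)
          then show "0 \<le> ?E / q\<^sup>2" "0 \<le> q\<^sup>2 * ?B" by auto
        qed (use D in \<open>auto simp: D_def\<close>)
        finally have "inverse L * \<eta>0\<^sup>2 * ?A \<le> (?E / q\<^sup>2 + q\<^sup>2 * ?B) * D"
          by (simp only: distrib_left mult.commute[of _ D])
        then have "inverse L * \<eta>0\<^sup>2 * ?A / D \<le> ?E / q\<^sup>2 + q\<^sup>2 * ?B"
          using D by (simp only: pos_divide_le_eq)
        then show "c * ?A \<le> ?E / q\<^sup>2 + q\<^sup>2 * ?B" by (simp add: c_def)
      qed
      have "L2_norm_torus (fourier_coeff k f t) \<le> exp 1 * L2_norm_torus (fourier_coeff k f 0) *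
          exp (- \<delta> * \<rho> * t)"
        unfolding \<delta>_def by (rule L2_norm_decay[OF const t])
      then show ?thesis by (simp add: \<rho>_def \<kappa>_def mult.assoc)
    qed
  qed
  have "0 < \<delta>" using const c L by (simp add: \<delta>_def)
  \<comment> \<open>The threshold \<open>\<nu>0\<close> is 1: together with
    \<open>1 \<le> \<kappa>\<close> it gives \<open>q \<le> 1\<close>.\<close>
  show ?thesis
    by (rule exI[of _ 1], rule conjI[OF zero_less_one], rule exI[of _ \<delta>], rule conjI[OF \<open>0 < \<delta>\<close>],
        intro ballI allI impI, elim conjE, rule decay; assumption)
qed

end
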